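(* The $A(\mathscr{T}^+)$-bimodule $A(\mathscr{T}^-)$ is generated by $[e]$ and $[f]$, where $[u]=u+O(\mathscr{T}^-)$ and $e,f\in\mathfrak{h}$ are identified with $e_{(-1)}|0\rangle,f_{(-1)}|0\rangle\in\mathscr{T}^-$.
   Context: Symplectic fermions. Let $\mathfrak{h}=\mathbb{C}e\oplus\mathbb{C}f$ carry the skew-symmetric form with $\langle e,e\rangle=\langle f,f\rangle=0$, $\langle e,f\rangle=-1$. Let $\hat{\mathfrak h}=\mathfrak{h}\otimes\mathbb{C}[t,t^{-1}]\oplus\mathbb{C}K$ be the Lie superalgebra with even part $\mathbb{C}K$ ($K$ central), odd part $\mathfrak{h}\otimes\mathbb{C}[t,t^{-1}]$ and $[\phi\otimes t^m,\psi\otimes t^n]_+=m\langle\phi,\psi\rangle\delta_{m+n,0}K$. Let $\mathscr{T}$ be the $\hat{\mathfrak h}$-module induced from the one-dimensional module of $\mathfrak{h}\otimes\mathbb{C}[t]\oplus\mathbb{C}K$ on which $\mathfrak{h}\otimes\mathbb{C}[t]$ acts by $0$ and $K$ by $1$; let $|0\rangle$ be its generator and $h_{(n)}$ the action of $h\otimes t^n$. $\mathscr{T}$ is spanned by $v=h^1_{(-n_1)}\cdots h^r_{(-n_r)}|0\rangle$ ($h^i\in\mathfrak{h}$, $n_i\in\mathbb{Z}_{>0}$, $r\ge0$), of weight $n_1+\cdots+n_r$; $\mathscr{T}^+$ (resp. $\mathscr{T}^-$) is the span of those with $r$ even (resp. odd). $\mathscr{T}$ is a simple vertex operator superalgebra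 with even part $\mathscr{T}^+$ and odd part $\mathscr{T}^-$, vacuum $|0\rangle$, Virasoro element $\omega=e_{(-1)}f_{(-1)}|0\rangle$ (central charge $-2$), and $Y(v,z)=\sum_n v_{(n)}z^{-n-1}={:}\partial^{(n_1-1)}h^1(z)\cdots\partial^{(n_r-1)}h^r(z){:}$ for $v=h^1_{(-n_1)}\cdots h^r_{(-n_r)}|0\rangle$, where $h(z)=\sum_{n\in\mathbb{Z}}h_{(n)}z^{-n-1}$, $\partial^{(k)}=\frac1{k!}(d/dz)^k$, and normal ordering is defined recursively by ${:}h^1_{(m_1)}\cdots h^r_{(m_r)}{:}=h^1_{(m_1)}{:}h^2_{(m_2)}\cdots h^r_{(m_r)}{:}$ if $m_1<0$ and $(-1)^{r-1}{:}h^2_{(m_2)}\cdots h^r_{(m_r)}{:}h^1_{(m_1)}$ if $m_1\ge0$. Thus $\mathscr{T}^+$ is a vertex operator algebra and $\mathscr{T}^-$ a $\mathscr{T}^+$-module. Zhu algebra and Frenkel–Zhu bimodules. For a vertex operator algebra $V$, a $V$-module $M$, homogeneous $a\in V$ of weight $|a|$ and $u\in M$, put $a\circ u=\sum_{i\ge0}\binom{|a|}{i}a_{(i-2)}u$, $a*u=\sum_{i\ge0}\binom{|a|}{i}a_{(i-1)}u$, $u*a=\sum_{i\ge0}\binom{|a|-1}{i}a_{(i-1)}u$, extended linearly in $a$. Let $O(M)$ be the span of all $a\circ u$ and $A(M)=M/O(M)$. Then $A(V)$ is an associative algebra under $*$ (Zhu's algebra) with unit $[|0\rangle]$, and $A(M)$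 is an $A(V)$-bimodule with the induced left and right actions. *)

theory Defs
  imports Complex_Main "HOL-Library.Poly_Mapping" "HOL-Library.FSet"
begin

section \<open>The symplectic fermion module\<close>

text \<open>
  \<^term>\<open>Em k\<close> and \<^term>\<open>Fm k\<close> stand for the creation modes \<open>e\<^sub>(\<^sub>-\<^sub>k\<^sub>-\<^sub>1\<^sub>)\<close> and \<open>f\<^sub>(\<^sub>-\<^sub>k\<^sub>-\<^sub>1\<^sub>)\<close>.
  The induced module has a basis indexed by finite sets of such modes; the set \<open>S\<close> stands for the
  product of its elements, in increasing order from left to right, applied to the vacuum.
  Theorems \<open>sf_act_anticommute\<close>, \<open>sf_act_vac\<close> and \<open>sf_induced_module\<close> below show that the
  space built in this way is the induced module.
\<close>

datatype sf_mode = Em nat | Fm nat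

fun sf_key :: "sf_mode \<Rightarrow> nat" where
  "sf_key (Em k) = 2 * k"
| "sf_key (Fm k) = 2 * k + 1"

lemma sf_key_inject: "sf_key x = sf_key y \<longleftrightarrow> x = y"
  by (cases x; cases y; simp; presburger)

instantiation sf_mode :: linorder
begin

definition "x \<le> y \<longleftrightarrow> sf_key x \<le> sf_key y"
definition "x < y \<longleftrightarrow> sf_key x < sf_key y"

instance
  by standard (auto simp: less_eq_sf_mode_def less_sf_mode_def sf_key_inject)

end

fun sf_mode_wt :: "sf_mode \<Rightarrow> nat" where
  "sf_mode_wt (Em k) = k + 1"
| "sf_mode_wt (Fm k) = k + 1"

type_synonym sf = "sf_mode fset \<Rightarrow>\<^sub>0 complex"

definition sf_scale :: "complex \<Rightarrow> sf \<Rightarrow> sf" (infixr "*\<^sub>T" 75) where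
  "c *\<^sub>T v = Poly_Mapping.map ((*) c) v"

lemma lookup_sf_scale [simp]: "Poly_Mapping.lookup (c *\<^sub>T v) S = c * Poly_Mapping.lookup v S"
  by (simp add: sf_scale_def map.rep_eq when_def)

interpretation sf: vector_space sf_scale
  by standard (auto intro!: poly_mapping_eqI simp: lookup_add algebra_simps)

abbreviation sf_basis :: "sf_mode fset \<Rightarrow> sf" where
  "sf_basis S \<equiv> Poly_Mapping.single S 1"

definition sf_vac :: sf where
  "sf_vac = sf_basis {||}"

definition sf_ext :: "(complex \<Rightarrow> 'b \<Rightarrow> 'b) \<Rightarrow> (sf_mode fset \<Rightarrow> 'b) \<Rightarrow> sf \<Rightarrow> 'b::comm_monoid_add" where
  "sf_ext s g a = (\<Sum>S \<in> Poly_Mapping.keys a. s (Poly_Mapping.lookup a S) (g S))"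

definition sf_sign :: "sf_mode \<Rightarrow> sf_mode fset \<Rightarrow> complex" where
  "sf_sign x S = (-1) ^ card {y \<in> fset S. y < x}"

definition sf_cre :: "sf_mode \<Rightarrow> sf_mode fset \<Rightarrow> sf" where
  "sf_cre x S = (if x |\<in>| S then 0 else sf_sign x S *\<^sub>T sf_basis (finsert x S))"

definition sf_ann :: "sf_mode \<Rightarrow> sf_mode fset \<Rightarrow> sf" where
  "sf_ann x S = (if x |\<in>| S then sf_sign x S *\<^sub>T sf_basis (S |-| {|x|}) else 0)"

text \<open>The pair \<open>(a, b)\<close> is the element \<open>a e + b f\<close> of the symplectic space.\<close>

type_synonym sf_h = "complex \<times> complex"

definition sf_e :: sf_h where "sf_e = (1, 0)"
definition sf_f :: sf_h where "sf_f = (0, 1)"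

definition sf_form :: "sf_h \<Rightarrow> sf_h \<Rightarrow> complex" where
  "sf_form h h' = snd h * fst h' - fst h * snd h'"

text \<open>
  \<^term>\<open>sf_act h n\<close> is the operator \<open>h\<^sub>(\<^sub>n\<^sub>)\<close>: multiplication by \<open>h\<^sub>(\<^sub>n\<^sub>)\<close> for \<open>n < 0\<close>, and
  the odd derivation with \<open>h'\<^sub>(\<^sub>-\<^sub>n\<^sub>) \<mapsto> n \<langle>h, h'\<rangle>\<close> for \<open>n \<ge> 0\<close>.
\<close>

definition sf_act :: "sf_h \<Rightarrow> int \<Rightarrow> sf \<Rightarrow> sf" where
  "sf_act h n = sf_ext sf_scale (\<lambda>S.
     if n < 0
     then fst h *\<^sub>T sf_cre (Em (nat (- n - 1))) S + snd h *\<^sub>T sf_cre (Fm (nat (- n - 1))) S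
     else (of_int n * sf_form h sf_e) *\<^sub>T sf_ann (Em (nat (n - 1))) S
        + (of_int n * sf_form h sf_f) *\<^sub>T sf_ann (Fm (nat (n - 1))) S)"

text \<open>
  The list \<open>[(h\<^sup>1, n\<^sub>1), \<dots>, (h\<^sup>r, n\<^sub>r)]\<close> encodes \<open>h\<^sup>1\<^sub>(\<^sub>-\<^sub>n\<^sub>1\<^sub>) \<cdots> h\<^sup>r\<^sub>(\<^sub>-\<^sub>n\<^sub>r\<^sub>) |0\<rangle>\<close>.
\<close>

definition sf_mono :: "(sf_h \<times> nat) list \<Rightarrow> sf" where
  "sf_mono hs = foldr (\<lambda>(h, n). sf_act h (- int n)) hs sf_vac"

definition sf_pos :: "(sf_h \<times> nat) list \<Rightarrow> bool" where
  "sf_pos hs \<longleftrightarrow> (\<forall>p \<in> set hs. 0 < snd p)"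

definition sf_plus :: "sf set" where
  "sf_plus = sf.span {sf_mono hs | hs. sf_pos hs \<and> even (length hs)}"

definition sf_minus :: "sf set" where
  "sf_minus = sf.span {sf_mono hs | hs. sf_pos hs \<and> odd (length hs)}"

definition sf_weight :: "nat \<Rightarrow> sf set" where
  "sf_weight d = sf.span {sf_mono hs | hs. sf_pos hs \<and> sum_list (map snd hs) = d}"


section \<open>Vertex operators\<close>

fun sf_normal :: "(sf_h \<times> int) list \<Rightarrow> sf \<Rightarrow> sf" where
  "sf_normal [] u = u"
| "sf_normal ((h, m) # hs) u =
     (if m < 0 then sf_act h m (sf_normal hs u)
      else (-1) ^ length hs *\<^sub>T sf_normal hs (sf_act h m u))"

text \<open>
  \<^term>\<open>sf_field hs k\<close> is the coefficient of \<open>z\<close> to the power \<open>- k - 1\<close> in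
  \<open>:\<partial>\<^sup>(\<^sup>n\<^sup>1\<^sup>-\<^sup>1\<^sup>)h\<^sup>1(z) \<cdots> \<partial>\<^sup>(\<^sup>n\<^sup>r\<^sup>-\<^sup>1\<^sup>)h\<^sup>r(z):\<close> for \<open>hs = [(h\<^sup>1, n\<^sub>1), \<dots>, (h\<^sup>r, n\<^sub>r)]\<close>. Here
  \<open>\<partial>\<^sup>(\<^sup>n\<^sup>-\<^sup>1\<^sup>)h(z)\<close> is the sum over all \<open>m\<close> of \<open>(- m - 1 gchoose (n - 1)) h\<^sub>(\<^sub>m\<^sub>)\<close> times \<open>z\<close> to the
  power \<open>- m - n\<close>. Only finitely many terms are nonzero on a given \<open>u\<close>: see
  \<open>sf_field_finite\<close>.
\<close>

definition sf_field_term :: "(sf_h \<times> nat) list \<Rightarrow> int list \<Rightarrow> sf \<Rightarrow> sf" where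
  "sf_field_term hs ms u =
     (\<Prod>(n, m) \<leftarrow> zip (map snd hs) ms. of_int (- m - 1) gchoose (n - 1))
       *\<^sub>T sf_normal (zip (map fst hs) ms) u"

definition sf_field_index :: "(sf_h \<times> nat) list \<Rightarrow> int \<Rightarrow> int list \<Rightarrow> bool" where
  "sf_field_index hs k ms \<longleftrightarrow>
     length ms = length hs \<and> sum_list ms + (\<Sum>p \<leftarrow> hs. int (snd p)) = k + 1"

definition sf_field :: "(sf_h \<times> nat) list \<Rightarrow> int \<Rightarrow> sf \<Rightarrow> sf" where
  "sf_field hs k u = Sum_any (\<lambda>ms. if sf_field_index hs k ms then sf_field_term hs ms u else 0)"

fun sf_gen :: "sf_mode \<Rightarrow> sf_h \<times> nat" where
  "sf_gen (Em k) = (sf_e, k + 1)"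
| "sf_gen (Fm k) = (sf_f, k + 1)"

text \<open>
  \<^term>\<open>sf_Y v k\<close> is \<open>v\<^sub>(\<^sub>k\<^sub>)\<close>, defined on the basis and extended linearly; \<open>sf_Y_mono\<close> is the
  formula for an arbitrary monomial \<open>v\<close>.
\<close>

definition sf_Y :: "sf \<Rightarrow> int \<Rightarrow> sf \<Rightarrow> sf" where
  "sf_Y v k u = sf_ext sf_scale (\<lambda>S. sf_field (map sf_gen (sorted_list_of_fset S)) k u) v"


section \<open>Zhu algebra and Frenkel-Zhu bimodule\<close>

definition sf_set_wt :: "sf_mode fset \<Rightarrow> nat" where
  "sf_set_wt S = (\<Sum>x \<in> fset S. sf_mode_wt x)"

text \<open>
  The three products, first for \<open>a\<close> of weight \<open>d\<close>. In the last one the upper index is \<open>-1\<close>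
  when \<open>d = 0\<close>, so that the generalised binomial coefficient is needed.
\<close>

definition sf_circ_hom :: "nat \<Rightarrow> sf \<Rightarrow> sf \<Rightarrow> sf" where
  "sf_circ_hom d a u = Sum_any (\<lambda>i::nat. of_nat (d choose i) *\<^sub>T sf_Y a (int i - 2) u)"

definition sf_left_hom :: "nat \<Rightarrow> sf \<Rightarrow> sf \<Rightarrow> sf" where
  "sf_left_hom d a u = Sum_any (\<lambda>i::nat. of_nat (d choose i) *\<^sub>T sf_Y a (int i - 1) u)"

definition sf_right_hom :: "nat \<Rightarrow> sf \<Rightarrow> sf \<Rightarrow> sf" where
  "sf_right_hom d u a =
     Sum_any (\<lambda>i::nat. ((of_nat d - 1) gchoose i) *\<^sub>T sf_Y a (int i - 1) u)"

definition sf_circ :: "sf \<Rightarrow> sf \<Rightarrow> sf" where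
  "sf_circ a u = sf_ext sf_scale (\<lambda>S. sf_circ_hom (sf_set_wt S) (sf_basis S) u) a"

definition sf_left :: "sf \<Rightarrow> sf \<Rightarrow> sf" where
  "sf_left a u = sf_ext sf_scale (\<lambda>S. sf_left_hom (sf_set_wt S) (sf_basis S) u) a"

definition sf_right :: "sf \<Rightarrow> sf \<Rightarrow> sf" where
  "sf_right u a = sf_ext sf_scale (\<lambda>S. sf_right_hom (sf_set_wt S) u (sf_basis S)) a"

text \<open>
  Below, \<open>M\<close> is one of the two modules \<open>sf_plus\<close>, \<open>sf_minus\<close> over the vertex operator algebra
  \<open>sf_plus\<close>, so that \<^term>\<open>zhu_A sf_plus\<close> is the Zhu algebra.
\<close>

definition zhu_O :: "sf set \<Rightarrow> sf set" where
  "zhu_O M = sf.span {sf_circ a u | a u. a \<in> sf_plus \<and> u \<in> M}"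

definition zhu_class :: "sf set \<Rightarrow> sf \<Rightarrow> sf set" where
  "zhu_class M u = {u + w | w. w \<in> zhu_O M}"

definition zhu_A :: "sf set \<Rightarrow> sf set set" where
  "zhu_A M = zhu_class M ` M"

text \<open>
  All operations on \<^term>\<open>zhu_A M\<close> are induced by operations on representatives, that is,
  \<open>[u] + [w] = [u + w]\<close>, \<open>c [u] = [c u]\<close>, \<open>[a] [u] = [a * u]\<close> and \<open>[u] [a] = [u * a]\<close>. A set
  of classes is closed under such an operation if it contains the results for all
  representatives of its members.
\<close>

definition zhu_subbimodule :: "sf set \<Rightarrow> sf set set \<Rightarrow> bool" where
  "zhu_subbimodule M N \<longleftrightarrow>
     N \<subseteq> zhu_A M \<and>
     zhu_class M 0 \<in> N \<and>
     (\<forall>U \<in> N. \<forall>W \<in> N. \<forall>u \<in> U. \<forall>w \<in> W. zhu_class M (u + w) \<in> N) \<and>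
     (\<forall>c. \<forall>U \<in> N. \<forall>u \<in> U. zhu_class M (c *\<^sub>T u) \<in> N) \<and>
     (\<forall>X \<in> zhu_A sf_plus. \<forall>U \<in> N. \<forall>a \<in> X. \<forall>u \<in> U.
        zhu_class M (sf_left a u) \<in> N \<and> zhu_class M (sf_right u a) \<in> N)"

definition zhu_generated :: "sf set \<Rightarrow> sf set set \<Rightarrow> sf set set" where
  "zhu_generated M G = \<Inter> {N. zhu_subbimodule M N \<and> G \<subseteq> N}"

section \<open>Alternating functions of lists\<close>

lemma sf_alternating_move:
  fixes G :: "'a::linorder list \<Rightarrow> 'b::ab_group_add"
  assumes swap: "\<And>as x y bs. G (as @ x # y # bs) = - G (as @ y # x # bs)"
    and rep: "\<And>as x bs. G (as @ x # x # bs) = 0"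
    and "sorted L" "distinct L"
  shows "G (as @ x # L) = (if x \<in> set L then 0
      else if even (card {y \<in> set L. y < x}) then G (as @ insort x L) else - G (as @ insort x L))"
  using assms(3,4)
proof (induction L arbitrary: as)
  case Nil
  then show ?case by simp
next
  case (Cons y L)
  consider "x = y" | "x < y" | "y < x" by fastforce
  then show ?case
  proof cases
    case 1
    then show ?thesis using rep[of as y L] by simp
  next
    case 2
    then have "x \<notin> set (y # L)" "{z \<in> set (y # L). z < x} = {}"
      using Cons.prems by fastforce+
    then show ?thesis using 2
      by (simp only: card.empty) (simp add: less_imp_le[OF 2])
  next
    case 3
    have "G (as @ x # y # L) = - G ((as @ [y]) @ x # L)"
      using swap[of as x y L] by simp
    moreover have "{z \<in> set (y # L). z < x} = insert y {z \<in> set L. z < x}"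
      using 3 by auto
    moreover have "y \<notin> {z \<in> set L. z < x}"
      using Cons.prems by auto
    ultimately show ?thesis
      using Cons.IH[of "as @ [y]"] Cons.prems 3 by (simp del: Cons.IH) force
  qed
qed

lemma sf_alternating_zero:
  fixes G :: "'a::linorder list \<Rightarrow> 'b::ab_group_add"
  assumes swap: "\<And>as x y bs. G (as @ x # y # bs) = - G (as @ y # x # bs)"
    and rep: "\<And>as x bs. G (as @ x # x # bs) = 0"
    and van: "\<And>L. sorted L \<Longrightarrow> distinct L \<Longrightarrow> G L = 0"
  shows "G L = 0"
proof -
  have "G (as @ L) = 0" if "sorted L" "distinct L" for as L
    using that
  proof (induction as arbitrary: L rule: rev_induct)
    case Nil
    then show ?case using van by simp
  next
    case (snoc x as)
    show ?case
    proof (cases "x \<in> set L")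
      case True
      then show ?thesis
        using sf_alternating_move[of G L as x, OF swap rep snoc.prems] by simp
    next
      case False
      then have "sorted (insort x L)" "distinct (insort x L)"
        using snoc.prems by (auto simp: sorted_insort distinct_insort)
      then have "G (as @ insort x L) = 0"
        by (rule snoc.IH)
      then show ?thesis
        using sf_alternating_move[of G L as x, OF swap rep snoc.prems] by simp
    qed
  qed
  from this[of "[]" L] show ?thesis by simp
qed


section \<open>Linear algebra\<close>

lemma sf_ext_superset:
  assumes "vector_space s" "finite A" "Poly_Mapping.keys a \<subseteq> A"
  shows "sf_ext s g a = (\<Sum>S \<in> A. s (Poly_Mapping.lookup a S) (g S))"
proof -
  interpret N: vector_space s by fact
  show ?thesis
    unfolding sf_ext_def
    using assms(2,3) by (intro sum.mono_neutral_left) (auto simp: in_keys_iff)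
qed

lemma keys_sf_scale: "Poly_Mapping.keys (c *\<^sub>T v) \<subseteq> Poly_Mapping.keys v"
  by (auto simp: in_keys_iff)

lemma sf_ext_linear:
  assumes "vector_space s"
  shows "Vector_Spaces.linear sf_scale s (sf_ext s g)"
proof -
  interpret N: vector_space s by fact
  have add: "sf_ext s g (a + b) = sf_ext s g a + sf_ext s g b" for a b
  proof -
    let ?A = "Poly_Mapping.keys a \<union> Poly_Mapping.keys b"
    have "Poly_Mapping.keys (a + b) \<subseteq> ?A"
      by (rule keys_add)
    then show ?thesis
      by (simp add: sf_ext_superset[OF assms, where A = ?A] lookup_add N.scale_left_distrib
          sum.distrib)
  qed
  have scale: "sf_ext s g (c *\<^sub>T a) = s c (sf_ext s g a)" for c a
    using keys_sf_scale[of c a]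
    by (simp add: sf_ext_superset[OF assms, where A = "Poly_Mapping.keys a"] N.scale_sum_right)
  show ?thesis
    by unfold_locales (rule add scale)+
qed

lemma sf_ext_basis:
  assumes "vector_space s"
  shows "sf_ext s g (sf_basis S) = g S"
proof -
  interpret N: vector_space s by fact
  show ?thesis by (simp add: sf_ext_def)
qed

lemma sf_expand: "v = (\<Sum>S \<in> Poly_Mapping.keys v. Poly_Mapping.lookup v S *\<^sub>T sf_basis S)"
proof (rule poly_mapping_eqI)
  fix T
  have "poly_mapping.lookup (\<Sum>S \<in> Poly_Mapping.keys v. Poly_Mapping.lookup v S *\<^sub>T sf_basis S) T
      = (\<Sum>S \<in> Poly_Mapping.keys v. if S = T then Poly_Mapping.lookup v S else 0)"
    by (simp add: lookup_sum lookup_single when_def if_distrib cong: if_cong)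
  also have "\<dots> = poly_mapping.lookup v T"
    by (simp add: sum.delta in_keys_iff)
  finally show "poly_mapping.lookup v T = poly_mapping.lookup
      (\<Sum>S \<in> Poly_Mapping.keys v. Poly_Mapping.lookup v S *\<^sub>T sf_basis S) T" by simp
qed

lemma sf_linear_eqI:
  assumes f: "Vector_Spaces.linear sf_scale s f" and g: "Vector_Spaces.linear sf_scale s g"
    and "\<And>S. f (sf_basis S) = g (sf_basis S)"
  shows "f v = g v"
proof -
  interpret f: Vector_Spaces.linear sf_scale s f by fact
  interpret g: Vector_Spaces.linear sf_scale s g by fact
  show ?thesis
    by (subst (1 2) sf_expand) (simp add: f.sum g.sum f.scale g.scale assms(3))
qed

lemma sf_linear_add:
  assumes "vector_space s" "Vector_Spaces.linear t s f" "Vector_Spaces.linear t s g"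
  shows "Vector_Spaces.linear t s (\<lambda>v. f v + g v)"
proof -
  interpret N: vector_space s by fact
  interpret f: Vector_Spaces.linear t s f by fact
  interpret g: Vector_Spaces.linear t s g by fact
  show ?thesis
    by unfold_locales (simp_all add: f.add g.add f.scale g.scale N.scale_right_distrib)
qed

lemma sf_linear_cmul:
  assumes "vector_space s" "Vector_Spaces.linear t s f"
  shows "Vector_Spaces.linear t s (\<lambda>v. s c (f v))"
proof -
  interpret N: vector_space s by fact
  interpret f: Vector_Spaces.linear t s f by fact
  show ?thesis
    by unfold_locales (simp_all add: f.add f.scale N.scale_right_distrib mult.commute)
qed

lemma sf_linear_null:
  assumes "vector_space s" "vector_space t"
  shows "Vector_Spaces.linear t s (\<lambda>v. 0)"
proof -
  interpret N: vector_space s by fact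
  interpret M: vector_space t by fact
  show ?thesis by unfold_locales simp_all
qed

abbreviation sf_linear :: "(sf \<Rightarrow> sf) \<Rightarrow> bool" where
  "sf_linear \<equiv> Vector_Spaces.linear sf_scale sf_scale"

lemma sf_linear_comp:
  assumes "Vector_Spaces.linear t s f" "Vector_Spaces.linear s r g"
  shows "Vector_Spaces.linear t r (\<lambda>v. g (f v))"
  using Vector_Spaces.linear_compose[OF assms] by (simp add: comp_def)

lemma sf_double_zero: "v = - v \<Longrightarrow> v = (0::sf)"
proof (rule poly_mapping_eqI)
  fix S assume "v = - v"
  then have "poly_mapping.lookup v S = - poly_mapping.lookup v S"
    by (metis lookup_uminus)
  then show "poly_mapping.lookup v S = poly_mapping.lookup 0 S" by simp
qed

section \<open>The relations\<close>

abbreviation sf_Cre :: "sf_mode \<Rightarrow> sf \<Rightarrow> sf" where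
  "sf_Cre x \<equiv> sf_ext sf_scale (sf_cre x)"

abbreviation sf_Ann :: "sf_mode \<Rightarrow> sf \<Rightarrow> sf" where
  "sf_Ann x \<equiv> sf_ext sf_scale (sf_ann x)"

lemmas sf_ext_lin = sf_ext_linear[OF sf.vector_space_axioms]
lemmas sf_ext_bas [simp] = sf_ext_basis[OF sf.vector_space_axioms]
lemma sf_linear_simps:
  assumes "Vector_Spaces.linear sf_scale s f"
  shows "f (u + v) = f u + f v" "f (c *\<^sub>T u) = s c (f u)" "f 0 = 0" "f (- u) = - f u"
    "f (u - v) = f u - f v"
proof -
  interpret f: Vector_Spaces.linear sf_scale s f by fact
  show "f (u + v) = f u + f v" "f (c *\<^sub>T u) = s c (f u)" "f 0 = 0" "f (- u) = - f u"
    "f (u - v) = f u - f v"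
    by (rule f.add f.scale f.zero f.neg f.diff)+
qed

lemmas sf_ext_simps [simp] = sf_linear_simps[OF sf_ext_lin]

lemma sf_sign_finsert:
  "y |\<notin>| S \<Longrightarrow> sf_sign x (finsert y S) = (if y < x then - sf_sign x S else sf_sign x S)"
proof -
  assume y: "y |\<notin>| S"
  have "{z \<in> fset (finsert y S). z < x} =
      (if y < x then insert y {z \<in> fset S. z < x} else {z \<in> fset S. z < x})"
    by auto
  then show ?thesis using y by (auto simp: sf_sign_def)
qed

lemma sf_sign_fminus:
  assumes "y |\<in>| S"
  shows "sf_sign x (S |-| {|y|}) = (if y < x then - sf_sign x S else sf_sign x S)"
proof -
  have "finsert y (S |-| {|y|}) = S" using assms by auto
  then show ?thesis
    using sf_sign_finsert[of y "S |-| {|y|}" x] by (auto split: if_splits)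
qed

lemma sf_sign_square [simp]: "sf_sign x S * sf_sign x S = 1"
  by (simp add: sf_sign_def flip: power_add mult_2)

lemma sf_Cre_Cre: "sf_Cre x (sf_Cre y u) + sf_Cre y (sf_Cre x u) = 0"
proof -
  have "sf_linear (\<lambda>u. sf_Cre x (sf_Cre y u) + sf_Cre y (sf_Cre x u))"
    by (intro sf_linear_add sf.vector_space_axioms sf_linear_comp[OF sf_ext_lin sf_ext_lin])
  moreover have "sf_linear (\<lambda>u. 0)"
    by (intro sf_linear_null sf.vector_space_axioms)
  moreover have "sf_Cre x (sf_Cre y (sf_basis S)) + sf_Cre y (sf_Cre x (sf_basis S)) = 0" for S
    by (cases "x = y"; cases "x < y")
      (auto simp: sf_cre_def sf_sign_finsert finsert_commute mult.commute)
  ultimately show ?thesis by (rule sf_linear_eqI)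
qed

lemma sf_Ann_Ann: "sf_Ann x (sf_Ann y u) + sf_Ann y (sf_Ann x u) = 0"
proof -
  have "sf_linear (\<lambda>u. sf_Ann x (sf_Ann y u) + sf_Ann y (sf_Ann x u))"
    by (intro sf_linear_add sf.vector_space_axioms sf_linear_comp[OF sf_ext_lin sf_ext_lin])
  moreover have "sf_linear (\<lambda>u. 0)"
    by (intro sf_linear_null sf.vector_space_axioms)
  moreover have "sf_Ann x (sf_Ann y (sf_basis S)) + sf_Ann y (sf_Ann x (sf_basis S)) = 0" for S
  proof -
    have comm: "S |-| {|x|} |-| {|y|} = S |-| {|y|} |-| {|x|}" by auto
    show ?thesis
    proof (cases "x |\<in>| S \<and> y |\<in>| S \<and> x \<noteq> y")
      case True
      then have "(x < y) = (\<not> y < x)" by auto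
      then show ?thesis using True
        by (simp add: sf_ann_def sf_sign_fminus comm mult.commute) auto
    next
      case False
      then show ?thesis by (auto simp: sf_ann_def)
    qed
  qed
  ultimately show ?thesis by (rule sf_linear_eqI)
qed

lemma sf_Cre_Ann: "sf_Cre x (sf_Ann y u) + sf_Ann y (sf_Cre x u) = (if x = y then u else 0)"
proof -
  have "sf_linear (\<lambda>u. sf_Cre x (sf_Ann y u) + sf_Ann y (sf_Cre x u))"
    by (intro sf_linear_add sf.vector_space_axioms sf_linear_comp[OF sf_ext_lin sf_ext_lin])
  moreover have "sf_linear (\<lambda>u. if x = y then u else 0)"
    by unfold_locales auto
  moreover have "sf_Cre x (sf_Ann y (sf_basis S)) + sf_Ann y (sf_Cre x (sf_basis S))
      = (if x = y then sf_basis S else 0)" for S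
  proof (cases "x = y")
    case True
    have "x |\<in>| S \<Longrightarrow> finsert x (S |-| {|x|}) = S" "x |\<notin>| S \<Longrightarrow> finsert x S |-| {|x|} = S"
      by auto
    then show ?thesis using True
      by (auto simp: sf_cre_def sf_ann_def sf_sign_finsert sf_sign_fminus)
  next
    case False
    then have comm: "finsert x S |-| {|y|} = finsert x (S |-| {|y|})" by auto
    show ?thesis
    proof (cases "x |\<notin>| S \<and> y |\<in>| S")
      case True
      then show ?thesis using False
        by (cases x y rule: linorder_cases)
          (simp_all add: sf_cre_def sf_ann_def sf_sign_finsert sf_sign_fminus comm mult.commute,
            (blast dest: less_asym)+)
    next
      case False
      then show ?thesis using \<open>x \<noteq> y\<close> by (auto simp: sf_cre_def sf_ann_def)
    qed
  qed
  ultimately show ?thesis by (rule sf_linear_eqI)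
qed

lemma sf_act_eq:
  "sf_act h n u =
     (if n < 0
      then fst h *\<^sub>T sf_Cre (Em (nat (- n - 1))) u + snd h *\<^sub>T sf_Cre (Fm (nat (- n - 1))) u
      else (of_int n * sf_form h sf_e) *\<^sub>T sf_Ann (Em (nat (n - 1))) u
        + (of_int n * sf_form h sf_f) *\<^sub>T sf_Ann (Fm (nat (n - 1))) u)"
  (is "_ = ?R u")
proof -
  have "sf_linear (sf_act h n)" unfolding sf_act_def by (rule sf_ext_lin)
  moreover have "sf_linear ?R"
    by (cases "n < 0"; simp only: if_True if_False; intro sf_linear_add sf_linear_cmul sf.vector_space_axioms sf_ext_lin)
  moreover have "sf_act h n (sf_basis S) = ?R (sf_basis S)" for S
    by (simp add: sf_act_def)
  ultimately show ?thesis by (rule sf_linear_eqI)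
qed

lemma sf_act_linear: "sf_linear (sf_act h n)"
  unfolding sf_act_def by (rule sf_ext_lin)

lemmas sf_act_simps = sf_linear_simps[OF sf_act_linear]

lemma sf_act_linear_left:
  "sf_act (a * fst h + b * fst h', a * snd h + b * snd h') n u
     = a *\<^sub>T sf_act h n u + b *\<^sub>T sf_act h' n u"
  by (simp add: sf_act_eq sf_form_def algebra_simps sf.scale_right_distrib sf.scale_left_distrib
      sf.scale_left_diff_distrib)

theorem sf_act_anticommute:
  "sf_act h m (sf_act h' n u) + sf_act h' n (sf_act h m u)
     = (if m + n = 0 then of_int m * sf_form h h' else 0) *\<^sub>T u"
proof -
  have *: "sf_act h m (sf_act h' n u) + sf_act h' n (sf_act h m u)
     = (if m + n = 0 then of_int m * sf_form h h' else 0) *\<^sub>T u" if "m < 0" "n \<ge> 0" for h h' m n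
  proof -
    define x y a b where "x = Em (nat (- m - 1))" "y = Fm (nat (- m - 1))"
      "a = Em (nat (n - 1))" "b = Fm (nat (n - 1))"
    note d = this
    define \<alpha> \<beta> where "\<alpha> = of_int n * sf_form h' sf_e" "\<beta> = of_int n * sf_form h' sf_f"
    note e = this
    have A: "sf_Ann q (sf_Cre p u) = (if p = q then u else 0) - sf_Cre p (sf_Ann q u)" for p q u
      using sf_Cre_Ann[of p q u] by (simp add: algebra_simps)
    have "sf_act h m (sf_act h' n u) + sf_act h' n (sf_act h m u)
      = (fst h * \<alpha>) *\<^sub>T (if x = a then u else 0) + (snd h * \<beta>) *\<^sub>T (if y = b then u else 0)"
      using that
      by (simp add: sf_act_eq flip: d e)
        (simp add: A d(2,3) d(1,4) sf.scale_right_distrib sf.scale_right_diff_distrib algebra_simps)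
    also have "\<dots> = (if m + n = 0 then of_int m * sf_form h h' else 0) *\<^sub>T u"
    proof (cases "n = 0")
      case True
      then show ?thesis using that by (simp add: e)
    next
      case False
      then have "x = a \<longleftrightarrow> m + n = 0" "y = b \<longleftrightarrow> m + n = 0"
        using that by (auto simp: d)
      moreover have "m + n = 0 \<Longrightarrow> of_int n = - (of_int m :: complex)"
        by (simp add: eq_neg_iff_add_eq_0 add.commute flip: of_int_add)
      ultimately show ?thesis
        by (auto simp: e sf_form_def sf_e_def sf_f_def algebra_simps simp flip: sf.scale_left_distrib)
    qed
    finally show ?thesis .
  qed
  have CC: "sf_Cre x (sf_Cre y u) = - sf_Cre y (sf_Cre x u)" for x y u
    using sf_Cre_Cre[of x y u] by (simp add: eq_neg_iff_add_eq_0)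
  have AA: "sf_Ann x (sf_Ann y u) = - sf_Ann y (sf_Ann x u)" for x y u
    using sf_Ann_Ann[of x y u] by (simp add: eq_neg_iff_add_eq_0)
  consider "m < 0" "n < 0" | "m \<ge> 0" "n \<ge> 0" | "m < 0" "n \<ge> 0" | "m \<ge> 0" "n < 0" by linarith
  then show ?thesis
  proof cases
    case 1
    define i j where "i = nat (- m - 1)" "j = nat (- n - 1)"
    note d = this
    show ?thesis using 1
      by (simp add: sf_act_eq flip: d)
        (simp add: CC[of "Em i" "Em j"] CC[of "Em i" "Fm j"] CC[of "Fm i" "Em j"] CC[of "Fm i" "Fm j"]
          sf.scale_right_distrib sf.scale_right_diff_distrib mult.commute)
  next
    case 2
    define i j where "i = nat (m - 1)" "j = nat (n - 1)"
    note d = this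
    have "m + n = 0 \<Longrightarrow> m = 0" using 2 by simp
    moreover have "sf_act h m (sf_act h' n u) + sf_act h' n (sf_act h m u) = 0"
      using 2
      by (simp add: sf_act_eq flip: d)
        (simp add: AA[of "Em i" "Em j"] AA[of "Em i" "Fm j"] AA[of "Fm i" "Em j"] AA[of "Fm i" "Fm j"]
          sf.scale_right_distrib sf.scale_right_diff_distrib mult_ac)
    ultimately show ?thesis by auto
  next
    case 3
    then show ?thesis by (rule *)
  next
    case 4
    then have "sf_act h' n (sf_act h m u) + sf_act h m (sf_act h' n u)
     = (if n + m = 0 then of_int n * sf_form h' h else 0) *\<^sub>T u"
      by (intro *)
    moreover have "n + m = 0 \<Longrightarrow> of_int n * sf_form h' h = of_int m * sf_form h h'"
    proof -
      assume "n + m = 0"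
      then have "n = - m" by simp
      then show ?thesis by (simp add: sf_form_def algebra_simps)
    qed
    ultimately show ?thesis by (simp add: add.commute)
  qed
qed

theorem sf_act_vac: "n \<ge> 0 \<Longrightarrow> sf_act h n sf_vac = 0"
  by (simp add: sf_act_eq sf_vac_def sf_ann_def)


section \<open>The universal property\<close>

lemma sf_act_gen: "sf_act (fst (sf_gen x)) (- int (snd (sf_gen x))) u = sf_Cre x u"
  by (cases x) (simp_all add: sf_act_eq sf_e_def sf_f_def)

lemma sf_mono_simps [simp]:
  "sf_mono [] = sf_vac"
  "sf_mono ((h, n) # hs) = sf_act h (- int n) (sf_mono hs)"
  by (simp_all add: sf_mono_def)

lemma sf_mono_gen_Cons: "sf_mono (sf_gen x # hs) = sf_Cre x (sf_mono hs)"
  using sf_act_gen[of x] by (cases "sf_gen x") simp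

lemma sf_Cre_basis:
  "x |\<notin>| S \<Longrightarrow> sf_basis (finsert x S) = sf_sign x S *\<^sub>T sf_Cre x (sf_basis S)"
  by (simp add: sf_cre_def)

lemma sf_mono_sorted:
  assumes "sorted L" "distinct L"
  shows "sf_mono (map sf_gen L) = sf_basis (fset_of_list L)"
  using assms
proof (induction L)
  case Nil
  then show ?case by (simp add: sf_vac_def)
next
  case (Cons x L)
  then have x: "x |\<notin>| fset_of_list L" by (simp add: fset_of_list_elem)
  have "{y \<in> fset (fset_of_list L). y < x} = {}"
    using Cons.prems by (fastforce simp: fset_of_list.rep_eq)
  then have "sf_sign x (fset_of_list L) = 1" by (simp only: sf_sign_def card.empty power_0)
  then show ?case
    using Cons x by (simp add: sf_mono_gen_Cons sf_cre_def)
qed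

lemma sf_sorted_list [simp]: "sorted (sorted_list_of_fset S)" "distinct (sorted_list_of_fset S)"
  by (simp_all add: sorted_list_of_fset.rep_eq)

lemma sf_sorted_list_of:
  "sorted L \<Longrightarrow> distinct L \<Longrightarrow> sorted_list_of_fset (fset_of_list L) = L"
  by (simp add: sorted_list_of_fset.rep_eq fset_of_list.rep_eq sorted_list_of_set.idem_if_sorted_distinct)

lemma sf_mono_basis: "sf_mono (map sf_gen (sorted_list_of_fset S)) = sf_basis S"
  by (simp add: sf_mono_sorted)

lemma sf_sorted_list_finsert:
  "x |\<notin>| S \<Longrightarrow> sorted_list_of_fset (finsert x S) = insort x (sorted_list_of_fset S)"
  by (simp add: sorted_list_of_fset.rep_eq)

theorem sf_induced_module:
  fixes s :: "complex \<Rightarrow> 'b::ab_group_add \<Rightarrow> 'b"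
    and act :: "sf_h \<Rightarrow> int \<Rightarrow> 'b \<Rightarrow> 'b" and K :: "'b \<Rightarrow> 'b" and w :: 'b
  assumes s: "vector_space s"
    and act_lin: "\<And>h n. Vector_Spaces.linear s s (act h n)"
    and act_left: "\<And>a b h h' n v. act (a * fst h + b * fst h', a * snd h + b * snd h') n v
      = s a (act h n v) + s b (act h' n v)"
    and K_lin: "Vector_Spaces.linear s s K"
    and K_central: "\<And>h n v. K (act h n v) = act h n (K v)"
    and rel: "\<And>h h' m n v. act h m (act h' n v) + act h' n (act h m v)
      = s (if m + n = 0 then of_int m * sf_form h h' else 0) (K v)"
    and w: "\<And>h n. n \<ge> 0 \<Longrightarrow> act h n w = 0" "K w = w"
  shows "\<exists>!\<phi>. Vector_Spaces.linear sf_scale s \<phi> \<and> \<phi> sf_vac = w \<and>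
           (\<forall>h n u. \<phi> (sf_act h n u) = act h n (\<phi> u))"
proof -
  interpret N: vector_space s by fact
  interpret act: Vector_Spaces.linear s s "act h n" for h n by fact
  define c where "c x = act (fst (sf_gen x)) (- int (snd (sf_gen x)))" for x
  interpret c: Vector_Spaces.linear s s "c x" for x unfolding c_def by fact
  have gen_pos: "snd (sf_gen x) > 0" for x by (cases x) auto
  have cc: "c x (c y v) = - c y (c x v)" for x y v
    using rel[of "fst (sf_gen x)" "- int (snd (sf_gen x))" "fst (sf_gen y)" "- int (snd (sf_gen y))" v]
      gen_pos[of x] gen_pos[of y]
    by (simp add: c_def eq_neg_iff_add_eq_0)
  have cx: "c x (c x v) = 0" for x v
  proof -
    have "s 2 (c x (c x v)) = s 1 (c x (c x v)) + s 1 (c x (c x v))"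
      using N.scale_left_distrib[of 1 1 "c x (c x v)"] by (simp only: one_add_one)
    also have "\<dots> = 0"
      using cc[of x x v] by (simp add: eq_neg_iff_add_eq_0)
    finally show ?thesis by simp
  qed
  define G where "G as = foldr c as w" for as
  have G_simps [simp]: "G [] = w" "G (x # as) = c x (G as)" for x as
    by (simp_all add: G_def)
  have G_swap: "G (as @ x # y # bs) = - G (as @ y # x # bs)" for as x y bs
  proof (induction as)
    case Nil
    show ?case by (simp add: cc[of x y])
  qed (simp add: c.neg)
  have G_rep: "G (as @ x # x # bs) = 0" for as x bs
    by (induction as) (simp_all add: cx)
  define \<phi> where "\<phi> = sf_ext s (\<lambda>S. G (sorted_list_of_fset S))"
  have \<phi>_lin: "Vector_Spaces.linear sf_scale s \<phi>"
    unfolding \<phi>_def by (rule sf_ext_linear[OF s])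
  interpret \<phi>: Vector_Spaces.linear sf_scale s \<phi> by fact
  have \<phi>_basis: "\<phi> (sf_basis S) = G (sorted_list_of_fset S)" for S
    by (simp add: \<phi>_def sf_ext_basis[OF s])
  have \<phi>_vac: "\<phi> sf_vac = w"
    unfolding sf_vac_def \<phi>_basis by (simp add: sorted_list_of_fset.rep_eq)
  have \<phi>_Cre: "\<phi> (sf_Cre x u) = c x (\<phi> u)" for x u
  proof (rule sf_linear_eqI[where s = s])
    show "Vector_Spaces.linear sf_scale s (\<lambda>u. \<phi> (sf_Cre x u))"
      by (rule sf_linear_comp[OF sf_ext_lin \<phi>_lin])
    show "Vector_Spaces.linear sf_scale s (\<lambda>u. c x (\<phi> u))"
      by (rule sf_linear_comp[OF \<phi>_lin]) (simp add: c_def act_lin)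
    fix S
    have "c x (G (sorted_list_of_fset S)) = G ([] @ x # sorted_list_of_fset S)" by simp
    also have "\<dots> = (if x |\<in>| S then 0
        else s (sf_sign x S) (G (insort x (sorted_list_of_fset S))))"
      by (subst sf_alternating_move[of G, OF G_swap G_rep])
        (auto simp: sf_sign_def)
    finally show "\<phi> (sf_Cre x (sf_basis S)) = c x (\<phi> (sf_basis S))"
      by (simp add: sf_cre_def \<phi>.scale \<phi>_basis sf_sorted_list_finsert)
  qed
  have K_G: "K (G L) = G L" for L
    by (induction L) (simp_all add: w c_def K_central)
  have K_\<phi>: "K (\<phi> u) = \<phi> u" for u
    by (rule sf_linear_eqI[OF sf_linear_comp[OF \<phi>_lin K_lin] \<phi>_lin]) (simp add: \<phi>_basis K_G)
  have gen: "act h n v = s (fst h) (act sf_e n v) + s (snd h) (act sf_f n v)" for h n v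
    using act_left[of "fst h" sf_e "snd h" sf_f n v] by (simp add: sf_e_def sf_f_def)
  have neg: "\<phi> (sf_act h n u) = act h n (\<phi> u)" if "n < 0" for h n u
  proof -
    define i where "i = nat (- n - 1)"
    have "n = - int (i + 1)" using that by (simp add: i_def)
    then show ?thesis
      using that unfolding gen[of h n] sf_act_eq
      by (simp add: \<phi>.add \<phi>.scale \<phi>_Cre c_def flip: i_def)
  qed
  have nonneg: "\<phi> (sf_act h n u) = act h n (\<phi> u)" if "n \<ge> 0" for h n u
  proof (rule sf_linear_eqI[where s = s])
    show "Vector_Spaces.linear sf_scale s (\<lambda>u. \<phi> (sf_act h n u))"
      by (rule sf_linear_comp[OF sf_act_linear \<phi>_lin])
    show "Vector_Spaces.linear sf_scale s (\<lambda>u. act h n (\<phi> u))"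
      by (rule sf_linear_comp[OF \<phi>_lin act_lin])
    fix S
    show "\<phi> (sf_act h n (sf_basis S)) = act h n (\<phi> (sf_basis S))"
    proof (induction S)
      case empty
      then show ?case
        using sf_act_vac[OF that] \<phi>_vac w(1)[OF that] by (simp add: sf_vac_def)
    next
      case (insert x S)
      let ?g = "fst (sf_gen x)" and ?m = "- int (snd (sf_gen x))" and ?u = "sf_basis S"
      let ?a = "if n + ?m = 0 then of_int n * sf_form h ?g else 0"
      have "sf_act h n (sf_Cre x ?u) = ?a *\<^sub>T ?u - sf_Cre x (sf_act h n ?u)"
        using sf_act_anticommute[of h n ?g ?m ?u] unfolding sf_act_gen
        by (simp only: eq_diff_eq)
      then have "\<phi> (sf_act h n (sf_Cre x ?u)) = s ?a (\<phi> ?u) - c x (act h n (\<phi> ?u))"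
        by (simp only: \<phi>.diff \<phi>.scale \<phi>_Cre insert.IH)
      also have "\<dots> = act h n (c x (\<phi> ?u))"
        using rel[of h n ?g ?m "\<phi> ?u"] unfolding c_def K_\<phi> by (simp only: diff_eq_eq)
      finally have "\<phi> (sf_act h n (sf_Cre x ?u)) = act h n (\<phi> (sf_Cre x ?u))"
        by (simp only: \<phi>_Cre)
      then show ?case
        by (simp only: sf_Cre_basis[OF insert.hyps] sf_act_simps \<phi>.scale act.scale)
    qed
  qed
  show ?thesis
  proof (rule ex1I[of _ \<phi>])
    show "Vector_Spaces.linear sf_scale s \<phi> \<and> \<phi> sf_vac = w \<and>
        (\<forall>h n u. \<phi> (sf_act h n u) = act h n (\<phi> u))"
      using \<phi>_lin \<phi>_vac neg nonneg by (metis not_le)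
  next
    fix \<psi>
    assume \<psi>: "Vector_Spaces.linear sf_scale s \<psi> \<and> \<psi> sf_vac = w \<and>
        (\<forall>h n u. \<psi> (sf_act h n u) = act h n (\<psi> u))"
    have mono: "\<psi> (sf_mono hs) = \<phi> (sf_mono hs)" for hs
    proof (induction hs)
      case Nil
      then show ?case using \<psi> \<phi>_vac by simp
    next
      case (Cons p hs)
      obtain h n where p: "p = (h, n)" by (cases p)
      have "\<phi> (sf_act h (- int n) v) = act h (- int n) (\<phi> v)" for v
        using neg nonneg by (metis not_le)
      moreover have "\<psi> (sf_act h (- int n) v) = act h (- int n) (\<psi> v)" for v
        using \<psi> by blast
      ultimately show ?case using Cons by (simp add: p)
    qed
    have "\<psi> v = \<phi> v" for v
    proof (rule sf_linear_eqI[where s = s])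
      show "Vector_Spaces.linear sf_scale s \<psi>" using \<psi> by blast
      show "\<psi> (sf_basis S) = \<phi> (sf_basis S)" for S
        using mono[of "map sf_gen (sorted_list_of_fset S)"] by (simp only: sf_mono_basis)
    qed (rule \<phi>_lin)
    then show "\<psi> = \<phi>" by blast
  qed
qed


section \<open>Properties of the vertex operators\<close>

subsection \<open>Finiteness\<close>

definition sf_bounded :: "nat \<Rightarrow> sf \<Rightarrow> bool" where
  "sf_bounded N u \<longleftrightarrow> (\<forall>S \<in> Poly_Mapping.keys u. \<forall>x \<in> fset S. sf_mode_wt x \<le> N)"

lemma sf_bounded_exists: "\<exists>N. sf_bounded N u"
proof -
  have "finite (\<Union>S \<in> Poly_Mapping.keys u. sf_mode_wt ` fset S)" by simp
  then obtain N where "\<forall>i \<in> (\<Union>S \<in> Poly_Mapping.keys u. sf_mode_wt ` fset S). i \<le> N"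
    using finite_nat_set_iff_bounded_le by blast
  then show ?thesis unfolding sf_bounded_def by auto
qed

lemma sf_keys_subspace: "sf.subspace {u::sf. \<forall>S \<in> Poly_Mapping.keys u. P S}"
proof (rule sf.subspaceI)
  fix x y :: sf and c
  assume "x \<in> {u. \<forall>S \<in> Poly_Mapping.keys u. P S}" "y \<in> {u. \<forall>S \<in> Poly_Mapping.keys u. P S}"
  then show "x + y \<in> {u. \<forall>S \<in> Poly_Mapping.keys u. P S}"
    using keys_add[of x y] by blast
qed (use keys_sf_scale in auto)

lemma sf_bounded_subspace: "sf.subspace {u. sf_bounded N u}"
  unfolding sf_bounded_def by (rule sf_keys_subspace)

lemma sf_ext_in_subspace:
  assumes "sf.subspace W" "\<And>S. S \<in> Poly_Mapping.keys u \<Longrightarrow> g S \<in> W"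
  shows "sf_ext sf_scale g u \<in> W"
  unfolding sf_ext_def using assms by (intro sf.subspace_sum sf.subspace_scale) auto

lemma sf_bounded_act:
  assumes "sf_bounded N u" "n \<ge> 0"
  shows "sf_bounded N (sf_act h n u)"
proof -
  have "sf_bounded N (sf_ann x S)" if "S \<in> Poly_Mapping.keys u" for x S
    using assms(1) that keys_sf_scale[of "sf_sign x S" "sf_basis (S |-| {|x|})"]
    by (auto simp: sf_bounded_def sf_ann_def split: if_splits)
  then have "sf_bounded N (sf_Ann x u)" for x
    using sf_ext_in_subspace[OF sf_bounded_subspace[of N], of u "sf_ann x"] by simp
  then show ?thesis
    using assms(2) sf_bounded_subspace[of N]
    by (simp add: sf_act_eq sf.subspace_def)
qed

lemma sf_act_bounded_zero:
  assumes "sf_bounded N u" "n > int N"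
  shows "sf_act h n u = 0"
proof -
  have "sf_Ann x u = 0" if "sf_mode_wt x > N" for x
  proof -
    have "sf_ann x S = 0" if "S \<in> Poly_Mapping.keys u" for S
      using assms(1) that \<open>sf_mode_wt x > N\<close> by (fastforce simp: sf_bounded_def sf_ann_def)
    then show ?thesis by (simp add: sf_ext_def)
  qed
  then show ?thesis using assms(2) by (simp add: sf_act_eq)
qed

lemma sf_normal_linear: "sf_linear (sf_normal hs)"
proof (induction hs)
  case Nil
  show ?case by unfold_locales simp_all
next
  case (Cons p hs)
  obtain h m where p: "p = (h, m)" by (cases p)
  show ?case
  proof (cases "m < 0")
    case True
    then have "sf_normal (p # hs) = (\<lambda>u. sf_act h m (sf_normal hs u))"
      by (auto simp: p)
    then show ?thesis using sf_linear_comp[OF Cons sf_act_linear] by simp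
  next
    case False
    then have "sf_normal (p # hs) = (\<lambda>u. (-1) ^ length hs *\<^sub>T sf_normal hs (sf_act h m u))"
      by (auto simp: p)
    then show ?thesis
      using sf_linear_cmul[OF sf.vector_space_axioms sf_linear_comp[OF sf_act_linear Cons]] by simp
  qed
qed

lemmas sf_normal_simps = sf_linear_simps[OF sf_normal_linear]

lemma sf_normal_bounded:
  assumes "sf_bounded N u" "sf_normal hs u \<noteq> 0" "p \<in> set hs"
  shows "snd p \<le> int N"
  using assms
proof (induction hs arbitrary: u)
  case Nil
  then show ?case by simp
next
  case (Cons q hs)
  obtain h m where q: "q = (h, m)" by (cases q)
  show ?case
  proof (cases "m < 0")
    case True
    then have "sf_normal hs u \<noteq> 0"
      using Cons.prems(2) by (auto simp: q sf_act_simps)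
    then show ?thesis
      using Cons.IH[OF Cons.prems(1)] Cons.prems(3) True by (auto simp: q)
  next
    case False
    then have nz: "sf_normal hs (sf_act h m u) \<noteq> 0"
      using Cons.prems(2) by (auto simp: q)
    then have "sf_act h m u \<noteq> 0"
      by (auto simp: sf_normal_simps)
    then have "m \<le> int N"
      using sf_act_bounded_zero[OF Cons.prems(1), of m h] by (cases "m \<le> int N") auto
    then show ?thesis
      using Cons.IH[OF sf_bounded_act[OF Cons.prems(1)] nz] Cons.prems(3) False by (auto simp: q)
  qed
qed

lemma sf_sum_list_upper:
  fixes ms :: "int list"
  assumes "\<forall>m \<in> set ms. m \<le> int N"
  shows "sum_list ms \<le> int N * int (length ms)"
    and "m \<in> set ms \<Longrightarrow> sum_list ms \<le> m + int N * int (length ms)"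
proof -
  show *: "sum_list ms \<le> int N * int (length ms)"
    using assms by (induction ms) (auto simp: algebra_simps)
  show "m \<in> set ms \<Longrightarrow> sum_list ms \<le> m + int N * int (length ms)"
    using assms
  proof (induction ms)
    case (Cons a ms)
    have "sum_list ms \<le> int N * int (length ms)"
      using Cons.prems(2) by (induction ms) (auto simp: algebra_simps)
    then show ?case using Cons by (auto simp: algebra_simps)
  qed simp
qed

lemma sf_normal_zip_bounded:
  assumes "sf_bounded N u" "length ms = length hs" "sf_normal (zip hs ms) u \<noteq> 0"
  shows "\<forall>m \<in> set ms. m \<le> int N"
  using sf_normal_bounded[OF assms(1,3)] assms(2)
  by (metis in_set_impl_in_set_zip2 snd_conv)

lemma sf_field_finite:
  "finite {ms. sf_field_index hs k ms \<and> sf_normal (zip (map fst hs) ms) u \<noteq> 0}"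
proof -
  obtain N where N: "sf_bounded N u" using sf_bounded_exists by blast
  define l where "l = k + 1 - (\<Sum>p \<leftarrow> hs. int (snd p)) - int N * int (length hs)"
  have "{ms. sf_field_index hs k ms \<and> sf_normal (zip (map fst hs) ms) u \<noteq> 0}
      \<subseteq> {ms. set ms \<subseteq> {l..int N} \<and> length ms = length hs}"
  proof (intro subsetI CollectI conjI)
    fix ms m
    assume ms: "ms \<in> {ms. sf_field_index hs k ms \<and> sf_normal (zip (map fst hs) ms) u \<noteq> 0}"
    then show "length ms = length hs" by (simp add: sf_field_index_def)
    have "\<forall>m \<in> set ms. m \<le> int N"
      using ms sf_normal_zip_bounded[OF N, of ms "map fst hs"] by (simp add: sf_field_index_def)
    moreover assume m: "m \<in> set ms"
    ultimately show "m \<in> {l..int N}"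
      using sf_sum_list_upper(2)[of ms N m] ms
      by (simp add: sf_field_index_def l_def)
  qed
  moreover have "finite {ms. set ms \<subseteq> {l..int N} \<and> length ms = length hs}"
    by (rule finite_lists_length_eq) simp
  ultimately show ?thesis by (rule finite_subset)
qed

lemma sf_field_support:
  "finite {ms. (if sf_field_index hs k ms then sf_field_term hs ms u else 0) \<noteq> 0}"
  by (rule finite_subset[OF _ sf_field_finite[of hs k u]]) (auto simp: sf_field_term_def)

lemma sf_field_truncation: "\<forall>\<^sub>F k in at_top. sf_field hs k u = 0"
proof -
  obtain N where N: "sf_bounded N u" using sf_bounded_exists by blast
  have "sf_field hs k u = 0"
    if k: "k \<ge> int N * int (length hs) + (\<Sum>p \<leftarrow> hs. int (snd p))" for k
  proof -
    have "(if sf_field_index hs k ms then sf_field_term hs ms u else 0) = 0" for ms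
    proof (rule ccontr)
      assume "(if sf_field_index hs k ms then sf_field_term hs ms u else 0) \<noteq> 0"
      then have i: "sf_field_index hs k ms" and "sf_normal (zip (map fst hs) ms) u \<noteq> 0"
        by (auto simp: sf_field_term_def split: if_splits)
      then have "\<forall>m \<in> set ms. m \<le> int N"
        using sf_normal_zip_bounded[OF N, of ms "map fst hs"] by (simp add: sf_field_index_def)
      then show False
        using sf_sum_list_upper(1)[of ms N] i k by (simp add: sf_field_index_def)
    qed
    then show ?thesis by (simp only: sf_field_def Sum_any.neutral)
  qed
  then show ?thesis by (auto simp: eventually_at_top_linorder)
qed

lemma sf_Sum_any_scale:
  assumes "finite {x. g x \<noteq> 0}"
  shows "Sum_any (\<lambda>x. c *\<^sub>T g x) = c *\<^sub>T Sum_any g"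
proof -
  have "{x. c *\<^sub>T g x \<noteq> 0} \<subseteq> {x. g x \<noteq> 0}" by auto
  then have "Sum_any (\<lambda>x. c *\<^sub>T g x) = (\<Sum>x | g x \<noteq> 0. c *\<^sub>T g x)"
    by (rule Sum_any.expand_superset[OF assms])
  then show ?thesis by (simp add: Sum_any.expand_set sf.scale_sum_right)
qed

lemma sf_field_linear: "sf_linear (sf_field hs k)"
proof -
  let ?t = "\<lambda>u ms. if sf_field_index hs k ms then sf_field_term hs ms u else 0"
  have "?t (u + v) = (\<lambda>ms. ?t u ms + ?t v ms)" for u v
    by (auto simp: sf_field_term_def sf_normal_simps sf.scale_right_distrib)
  then have a: "sf_field hs k (u + v) = sf_field hs k u + sf_field hs k v" for u v
    unfolding sf_field_def by (simp only: Sum_any.distrib[OF sf_field_support sf_field_support])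
  have "?t (c *\<^sub>T u) = (\<lambda>ms. c *\<^sub>T ?t u ms)" for c u
    by (auto simp: sf_field_term_def sf_normal_simps mult.commute)
  then have b: "sf_field hs k (c *\<^sub>T u) = c *\<^sub>T sf_field hs k u" for c u
    unfolding sf_field_def by (simp only: sf_Sum_any_scale[OF sf_field_support])
  show ?thesis by unfold_locales (rule a b)+
qed

theorem sf_Y_linear_left: "sf_linear (\<lambda>v. sf_Y v k u)"
  unfolding sf_Y_def by (rule sf_ext_lin)

theorem sf_Y_linear_right: "sf_linear (sf_Y v k)"
proof -
  note f = sf_linear_simps[OF sf_field_linear]
  show ?thesis
    by unfold_locales
      (simp_all add: sf_Y_def sf_ext_def f sf.scale_right_distrib sum.distrib sf.scale_sum_right
        mult.commute)
qed

theorem sf_Y_truncation: "\<forall>\<^sub>F k in at_top. sf_Y v k u = 0"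
proof -
  have "\<forall>\<^sub>F k in at_top. \<forall>S \<in> Poly_Mapping.keys v.
      sf_field (map sf_gen (sorted_list_of_fset S)) k u = 0"
    by (intro eventually_ball_finite ballI sf_field_truncation) simp
  then show ?thesis by eventually_elim (simp add: sf_Y_def sf_ext_def)
qed


subsection \<open>The formula for monomials\<close>

lemma sf_act_swap: "m + n \<noteq> 0 \<or> m = 0 \<Longrightarrow> sf_act h m (sf_act h' n u) = - sf_act h' n (sf_act h m u)"
  using sf_act_anticommute[of h m h' n u] by (auto simp: eq_neg_iff_add_eq_0 split: if_splits)

lemma sf_normal_swap: "sf_normal (as @ p # q # bs) u = - sf_normal (as @ q # p # bs) u"
proof (induction as arbitrary: u)
  case Nil
  obtain h m h' n where [simp]: "p = (h, m)" "q = (h', n)" by (metis surj_pair)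
  consider "m < 0" "n < 0" | "m \<ge> 0" "n \<ge> 0" | "m < 0" "n \<ge> 0" | "m \<ge> 0" "n < 0" by linarith
  then show ?case
  proof cases
    case 1
    then show ?thesis by (simp add: sf_act_swap[of m n])
  next
    case 2
    then have "sf_act h' n (sf_act h m u) = - sf_act h m (sf_act h' n u)"
      by (intro sf_act_swap) auto
    then show ?thesis using 2 by (simp add: sf_normal_simps)
  qed (simp_all add: sf_act_simps)
next
  case (Cons r as)
  obtain h m where "r = (h, m)" by (cases r)
  then show ?case using Cons[of u] Cons[of "sf_act h m u"] by (auto simp: sf_act_simps)
qed

lemma sf_normal_multilinear:
  "sf_normal (as @ ((a * fst h + b * fst h', a * snd h + b * snd h'), m) # bs) u
     = a *\<^sub>T sf_normal (as @ (h, m) # bs) u + b *\<^sub>T sf_normal (as @ (h', m) # bs) u"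
proof (induction as arbitrary: u)
  case Nil
  show ?case
    by (simp add: sf_act_linear_left sf_normal_simps sf.scale_right_distrib mult.commute)
next
  case (Cons r as)
  obtain h m where "r = (h, m)" by (cases r)
  then show ?case using Cons
    by (auto simp: sf_act_simps sf.scale_right_distrib mult.commute)
qed

definition sf_swap :: "nat \<Rightarrow> int list \<Rightarrow> int list" where
  "sf_swap i ms =
     (if i + 1 < length ms then ms[i := ms ! (i + 1), i + 1 := ms ! i] else ms)"

lemma sf_swap_append: "sf_swap (length as) (as @ a # b # bs) = as @ b # a # bs"
  by (simp add: sf_swap_def list_update_append nth_append)

lemma sf_split_at:
  assumes "i + 1 < length ms"
  obtains as a b bs where "ms = as @ a # b # bs" "length as = i"
proof -
  have "ms = take i ms @ ms ! i # ms ! (i + 1) # drop (i + 2) ms"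
    using assms by (metis Cons_nth_drop_Suc Suc_eq_plus1 add_2_eq_Suc' add_lessD1 append_take_drop_id)
  then show thesis using that assms by (metis add_lessD1 length_take min.absorb4)
qed

lemma sf_swap_swap: "sf_swap i (sf_swap i ms) = ms"
proof (cases "i + 1 < length ms")
  case True
  then obtain as a b bs where "ms = as @ a # b # bs" "length as = i" by (rule sf_split_at)
  then show ?thesis using sf_swap_append[of as a b bs] sf_swap_append[of as b a bs] by simp
qed (simp add: sf_swap_def)

lemma sf_field_swap: "sf_field (as @ p # q # bs) k u = - sf_field (as @ q # p # bs) k u"
proof -
  let ?t = "\<lambda>hs ms. if sf_field_index hs k ms then sf_field_term hs ms u else 0"
  let ?A = "as @ p # q # bs" and ?B = "as @ q # p # bs"
  have "bij (sf_swap (length as))"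
    by (rule involuntory_imp_bij) (rule sf_swap_swap)
  moreover have "?t ?A \<circ> sf_swap (length as) = (\<lambda>ms. (-1) *\<^sub>T ?t ?B ms)"
  proof
    fix ms
    show "(?t ?A \<circ> sf_swap (length as)) ms = (-1) *\<^sub>T ?t ?B ms"
    proof (cases "length ms = length ?B")
      case True
      then have "length as + 1 < length ms" by simp
      then obtain cs c d ds where ms: "ms = cs @ c # d # ds" "length cs = length as"
        by (rule sf_split_at)
      have sw: "sf_swap (length as) ms = cs @ d # c # ds"
        using ms sf_swap_append[of cs] by simp
      have "sf_field_index ?A k (cs @ d # c # ds) \<longleftrightarrow> sf_field_index ?B k ms"
        by (auto simp: sf_field_index_def ms)
      moreover have "sf_field_term ?A (cs @ d # c # ds) u = - sf_field_term ?B ms u"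
        using ms(2)
        by (simp add: ms(1) sf_field_term_def mult_ac sf_normal_swap[of _ "(fst p, d)" "(fst q, c)"])
      ultimately show ?thesis by (simp add: sw)
    next
      case False
      moreover have "length (sf_swap (length as) ms) = length ms" by (simp add: sf_swap_def)
      ultimately show ?thesis by (simp add: sf_field_index_def)
    qed
  qed
  ultimately have "sf_field ?A k u = Sum_any (\<lambda>ms. (-1) *\<^sub>T ?t ?B ms)"
    unfolding sf_field_def by (rule Sum_any.reindex_cong)
  also have "\<dots> = (-1) *\<^sub>T Sum_any (?t ?B)"
    by (rule sf_Sum_any_scale) (rule sf_field_support)
  finally show ?thesis by (simp add: sf_field_def)
qed

lemma sf_field_rep: "sf_field (as @ p # p # bs) k u = 0"
  by (rule sf_double_zero) (rule sf_field_swap)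

lemma sf_field_multilinear:
  "sf_field (as @ ((a * fst h + b * fst h', a * snd h + b * snd h'), n) # bs) k u
     = a *\<^sub>T sf_field (as @ (h, n) # bs) k u + b *\<^sub>T sf_field (as @ (h', n) # bs) k u"
  (is "sf_field ?A k u = a *\<^sub>T sf_field ?B k u + b *\<^sub>T sf_field ?C k u")
proof -
  let ?t = "\<lambda>hs ms. if sf_field_index hs k ms then sf_field_term hs ms u else 0"
  have "?t ?A ms = a *\<^sub>T ?t ?B ms + b *\<^sub>T ?t ?C ms" for ms
  proof (cases "sf_field_index ?A k ms")
    case True
    then have "sf_field_index ?B k ms" "sf_field_index ?C k ms"
      by (simp_all add: sf_field_index_def)
    moreover have "length as < length ms" using True by (simp add: sf_field_index_def)
    then obtain cs c ds where ms: "ms = cs @ c # ds" "length cs = length as"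
      by (metis id_take_nth_drop length_take min.absorb4)
    have "sf_field_term ?A ms u = a *\<^sub>T sf_field_term ?B ms u + b *\<^sub>T sf_field_term ?C ms u"
      using ms(2)
      by (simp add: ms(1) sf_field_term_def sf_normal_multilinear sf.scale_right_distrib mult_ac)
    ultimately show ?thesis using True by simp
  next
    case False
    then have "\<not> sf_field_index ?B k ms" "\<not> sf_field_index ?C k ms"
      by (simp_all add: sf_field_index_def)
    then show ?thesis using False by simp
  qed
  then have "sf_field ?A k u = Sum_any (\<lambda>ms. a *\<^sub>T ?t ?B ms + b *\<^sub>T ?t ?C ms)"
    unfolding sf_field_def by (rule Sum_any.cong)
  also have "\<dots> = Sum_any (\<lambda>ms. a *\<^sub>T ?t ?B ms) + Sum_any (\<lambda>ms. b *\<^sub>T ?t ?C ms)"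
    by (rule Sum_any.distrib; rule finite_subset[OF _ sf_field_support]) auto
  also have "\<dots> = a *\<^sub>T Sum_any (?t ?B) + b *\<^sub>T Sum_any (?t ?C)"
    by (simp only: sf_Sum_any_scale[OF sf_field_support])
  finally show ?thesis by (simp only: sf_field_def)
qed

lemma sf_mono_multilinear:
  "sf_mono (as @ ((a * fst h + b * fst h', a * snd h + b * snd h'), n) # bs)
     = a *\<^sub>T sf_mono (as @ (h, n) # bs) + b *\<^sub>T sf_mono (as @ (h', n) # bs)"
proof (induction as)
  case Nil
  show ?case by (simp add: sf_act_linear_left)
next
  case (Cons p as)
  then show ?case by (cases p) (simp add: sf_act_simps)
qed

lemma sf_mono_gen_swap:
  "sf_mono (map sf_gen as @ sf_gen x # sf_gen y # bs) =
    - sf_mono (map sf_gen as @ sf_gen y # sf_gen x # bs)"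
proof (induction as)
  case Nil
  show ?case using sf_Cre_Cre[of x y] by (simp add: sf_mono_gen_Cons eq_neg_iff_add_eq_0)
next
  case (Cons z as)
  then show ?case by (simp add: sf_mono_gen_Cons)
qed

theorem sf_Y_mono:
  assumes "sf_pos hs"
  shows "sf_Y (sf_mono hs) k u = sf_field hs k u"
proof -
  note Yl = sf_linear_simps[OF sf_Y_linear_left]
  have "sf_Y (sf_mono (map sf_gen L @ hs)) k u = sf_field (map sf_gen L @ hs) k u" for L
    using assms
  proof (induction hs arbitrary: L)
    case Nil
    define G where "G L = sf_Y (sf_mono (map sf_gen L)) k u - sf_field (map sf_gen L) k u" for L
    have "G L = 0"
    proof (rule sf_alternating_zero[of G])
      fix as x y bs
      show "G (as @ x # y # bs) = - G (as @ y # x # bs)"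
        using sf_mono_gen_swap[of as x y "map sf_gen bs"]
          sf_field_swap[of "map sf_gen as" "sf_gen x" "sf_gen y" "map sf_gen bs" k u]
        by (simp add: G_def Yl)
      have "sf_mono (map sf_gen as @ sf_gen x # sf_gen x # map sf_gen bs) = 0"
        by (rule sf_double_zero) (rule sf_mono_gen_swap)
      then show "G (as @ x # x # bs) = 0"
        by (simp add: G_def Yl sf_field_rep)
    next
      fix L :: "sf_mode list" assume "sorted L" "distinct L"
      then show "G L = 0"
        by (simp add: G_def sf_mono_sorted sf_Y_def sf_sorted_list_of)
    qed
    then show ?case by (simp add: G_def)
  next
    case (Cons p hs)
    obtain h n where p: "p = (h, n)" by (cases p)
    then have "sf_pos hs" and n: "n > 0" using Cons.prems by (auto simp: sf_pos_def)
    then have IH: "sf_Y (sf_mono (map sf_gen L @ sf_gen x # hs)) k u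
        = sf_field (map sf_gen L @ sf_gen x # hs) k u" for x
      using Cons.IH[of "L @ [x]"] by simp
    have h: "h = (fst h * fst sf_e + snd h * fst sf_f, fst h * snd sf_e + snd h * snd sf_f)"
      by (simp add: sf_e_def sf_f_def)
    have "sf_gen (Em (n - 1)) = (sf_e, n)" "sf_gen (Fm (n - 1)) = (sf_f, n)"
      using n by simp_all
    then show ?case
      unfolding p using IH[of "Em (n - 1)"] IH[of "Fm (n - 1)"]
      by (subst (1 2) h) (simp only: sf_mono_multilinear sf_field_multilinear Yl)
  qed
  from this[of "[]"] show ?thesis by simp
qed


subsection \<open>Weights and the three products\<close>

lemma sf_mono_keys:
  assumes "sf_pos hs" "S \<in> Poly_Mapping.keys (sf_mono hs)"
  shows "sf_set_wt S = sum_list (map snd hs)"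
  using assms
proof (induction hs arbitrary: S)
  case Nil
  then show ?case by (simp add: sf_vac_def sf_set_wt_def)
next
  case (Cons p hs)
  obtain h n where p: "p = (h, n)" by (cases p)
  define W where "W d = {u::sf. \<forall>S \<in> Poly_Mapping.keys u. sf_set_wt S = d}" for d
  have W: "sf.subspace (W d)" for d
    unfolding W_def by (rule sf_keys_subspace)
  have n: "n > 0" and hs: "sf_pos hs" using Cons.prems by (auto simp: p sf_pos_def)
  have "sf_Cre x (sf_mono hs) \<in> W (sf_mode_wt x + sum_list (map snd hs))" for x
  proof (rule sf_ext_in_subspace[OF W])
    fix S assume "S \<in> Poly_Mapping.keys (sf_mono hs)"
    then have "sf_set_wt S = sum_list (map snd hs)" by (rule Cons.IH[OF hs])
    moreover have "x |\<notin>| S \<Longrightarrow> sf_set_wt (finsert x S) = sf_mode_wt x + sf_set_wt S"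
      by (simp add: sf_set_wt_def)
    moreover have "Poly_Mapping.keys (sf_sign x S *\<^sub>T sf_basis (finsert x S)) \<subseteq> {finsert x S}"
      using keys_sf_scale[of "sf_sign x S" "sf_basis (finsert x S)"] by simp
    ultimately show "sf_cre x S \<in> W (sf_mode_wt x + sum_list (map snd hs))"
      by (auto simp: sf_cre_def W_def)
  qed
  from this[of "Em (n - 1)"] this[of "Fm (n - 1)"] have "sf_mono (p # hs) \<in> W (sum_list (map snd (p # hs)))"
    using n W[of "n + sum_list (map snd hs)"]
    by (simp add: p sf_act_eq nat_diff_distrib sf.subspace_def)
  then show ?case using Cons.prems(2) by (simp add: W_def)
qed

lemma sf_weight_keys:
  assumes "a \<in> sf_weight d" "S \<in> Poly_Mapping.keys a"
  shows "sf_set_wt S = d"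
proof -
  let ?W = "{u::sf. \<forall>S \<in> Poly_Mapping.keys u. sf_set_wt S = d}"
  have "sf.subspace ?W"
    by (rule sf_keys_subspace)
  then have "sf_weight d \<subseteq> ?W"
    unfolding sf_weight_def using sf_mono_keys by (intro sf.span_minimal) auto
  then show ?thesis using assms by blast
qed

lemma sf_product_finite: "finite {i::nat. c i *\<^sub>T sf_Y a (int i - j) u \<noteq> 0}"
proof -
  obtain K where K: "\<forall>k \<ge> K. sf_Y a k u = 0"
    using sf_Y_truncation[of a u] by (auto simp: eventually_at_top_linorder)
  have "{i::nat. c i *\<^sub>T sf_Y a (int i - j) u \<noteq> 0} \<subseteq> {..nat (K + j)}"
  proof
    fix i assume "i \<in> {i::nat. c i *\<^sub>T sf_Y a (int i - j) u \<noteq> 0}"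
    then have "\<not> K \<le> int i - j" using K by auto
    then show "i \<in> {..nat (K + j)}" by auto
  qed
  then show ?thesis by (rule finite_subset) simp
qed

lemma sf_product_linear: "sf_linear (\<lambda>a. Sum_any (\<lambda>i::nat. c i *\<^sub>T sf_Y a (int i - j) u))"
proof -
  note Yl = sf_linear_simps[OF sf_Y_linear_left]
  have "Sum_any (\<lambda>i::nat. c i *\<^sub>T sf_Y (x *\<^sub>T a) (int i - j) u)
      = x *\<^sub>T Sum_any (\<lambda>i::nat. c i *\<^sub>T sf_Y a (int i - j) u)" for x a
    by (subst sf_Sum_any_scale[OF sf_product_finite, symmetric]) (simp add: Yl mult.commute)
  moreover have "Sum_any (\<lambda>i::nat. c i *\<^sub>T sf_Y (a + b) (int i - j) u)
      = Sum_any (\<lambda>i::nat. c i *\<^sub>T sf_Y a (int i - j) u)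
        + Sum_any (\<lambda>i::nat. c i *\<^sub>T sf_Y b (int i - j) u)" for a b
    by (subst Sum_any.distrib[OF sf_product_finite sf_product_finite, symmetric])
      (simp add: Yl sf.scale_right_distrib)
  ultimately show ?thesis by unfold_locales simp_all
qed

lemma sf_ext_weight:
  assumes "a \<in> sf_weight d" "\<And>d. sf_linear (g d)"
  shows "sf_ext sf_scale (\<lambda>S. g (sf_set_wt S) (sf_basis S)) a = g d a"
proof -
  interpret g: Vector_Spaces.linear sf_scale sf_scale "g d" by (rule assms(2))
  have "sf_ext sf_scale (\<lambda>S. g (sf_set_wt S) (sf_basis S)) a
      = (\<Sum>S \<in> Poly_Mapping.keys a. Poly_Mapping.lookup a S *\<^sub>T g d (sf_basis S))"
    unfolding sf_ext_def using sf_weight_keys[OF assms(1)] by (intro sum.cong) auto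
  also have "\<dots> = g d (\<Sum>S \<in> Poly_Mapping.keys a. Poly_Mapping.lookup a S *\<^sub>T sf_basis S)"
    by (simp add: g.sum g.scale)
  finally show ?thesis by (simp flip: sf_expand)
qed

theorem sf_products_homogeneous:
  assumes "a \<in> sf_weight d"
  shows "sf_circ a u = sf_circ_hom d a u"
    and "sf_left a u = sf_left_hom d a u"
    and "sf_right u a = sf_right_hom d u a"
  unfolding sf_circ_def sf_left_def sf_right_def
  using sf_ext_weight[OF assms, of "\<lambda>d a. sf_circ_hom d a u"]
    sf_ext_weight[OF assms, of "\<lambda>d a. sf_left_hom d a u"]
    sf_ext_weight[OF assms, of "\<lambda>d a. sf_right_hom d u a"]
    sf_product_linear
  by (simp_all add: sf_circ_hom_def sf_left_hom_def sf_right_hom_def)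

end

theory Submission
  imports Defs
begin

text \<open>
  Filter \<open>\<T>\<^sup>-\<close> by the number of modes. Normal ordering gives
  \<open>(x\<^sub>(\<^sub>-\<^sub>m\<^sub>) y\<^sub>(\<^sub>-\<^sub>n\<^sub>) |0\<rangle>) * u = x\<^sub>(\<^sub>-\<^sub>m\<^sub>) y\<^sub>(\<^sub>-\<^sub>n\<^sub>) u\<close> up to terms that are not longer than \<open>u\<close>, so the left
  action generates everything from the vectors \<open>x\<^sub>(\<^sub>-\<^sub>n\<^sub>) |0\<rangle>\<close>. For \<open>x \<in> {e, f}\<close>,
  \<open>a = x\<^sub>(\<^sub>-\<^sub>m\<^sub>) y\<^sub>(\<^sub>-\<^sub>1\<^sub>) |0\<rangle>\<close> and \<open>u = x\<^sub>(\<^sub>-\<^sub>1\<^sub>) |0\<rangle>\<close> one computes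
  \<open>a * u - u * a = m \<langle>y, x\<rangle> (x\<^sub>(\<^sub>-\<^sub>m\<^sub>-\<^sub>1\<^sub>) + x\<^sub>(\<^sub>-\<^sub>m\<^sub>)) |0\<rangle>\<close>, so these vectors are generated by \<open>e\<close> and
  \<open>f\<close>, by induction on \<open>m\<close>. No element of \<open>O(\<T>\<^sup>-)\<close> is needed.
\<close>

section \<open>Sums of finite support and linear maps on spans\<close>

lemma sf_Sum_any_in_subspace:
  assumes "sf.subspace W" "\<And>i. g i \<in> W"
  shows "Sum_any g \<in> W"
  unfolding Sum_any.expand_set using assms by (intro sf.subspace_sum)

lemma sf_Sum_any_diff:
  fixes g h :: "'i \<Rightarrow> sf"
  assumes "finite {i. g i \<noteq> 0}" "finite {i. h i \<noteq> 0}"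
  shows "Sum_any g - Sum_any h = Sum_any (\<lambda>i. g i - h i)"
proof -
  have "finite {i. g i - h i \<noteq> 0}"
    by (rule finite_subset[OF _ finite_UnI[OF assms]]) auto
  from Sum_any.distrib[OF this assms(2)] show ?thesis by simp
qed

lemma sf_Sum_any_single:
  fixes g :: "'i \<Rightarrow> sf"
  assumes "\<And>i. i \<noteq> j \<Longrightarrow> g i = 0"
  shows "Sum_any g = g j"
proof -
  have "Sum_any g = sum g {j}"
    by (rule Sum_any.expand_superset) (use assms in auto)
  then show ?thesis by simp
qed

text \<open>Subtracting the family that is \<open>v\<close> at \<open>j\<close> and zero elsewhere
  leaves a family with all terms in \<open>W\<close>. Finite support matters because
  \<open>Sum_any\<close> is 0 on infinite support.\<close>

lemma sf_Sum_any_leading: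
  fixes g :: "'i \<Rightarrow> sf"
  assumes "sf.subspace W" "finite {i. g i \<noteq> 0}" "g j - v \<in> W" "\<And>i. i \<noteq> j \<Longrightarrow> g i \<in> W"
  shows "Sum_any g - v \<in> W"
proof -
  let ?h = "\<lambda>i. if i = j then v else 0"
  have "Sum_any ?h = v"
    using sf_Sum_any_single[of j ?h] by simp
  moreover have "finite {i. ?h i \<noteq> 0}" by (rule finite_subset[of _ "{j}"]) auto
  moreover have "Sum_any (\<lambda>i. g i - ?h i) \<in> W"
    by (rule sf_Sum_any_in_subspace[OF assms(1)]) (use assms(3,4) in auto)
  ultimately show ?thesis using sf_Sum_any_diff[OF assms(2), of ?h] by simp
qed

lemma sf_linear_span_subset:
  assumes "sf_linear g" "sf.subspace W" "\<And>b. b \<in> B \<Longrightarrow> g b \<in> W" "u \<in> sf.span B"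
  shows "g u \<in> W"
  using assms(4)
proof (induction rule: sf.span_induct_alt)
  case base
  show ?case using assms(2) by (simp add: sf_linear_simps[OF assms(1)] sf.subspace_0)
next
  case (step c x y)
  then show ?case using assms(2,3)
    by (simp add: sf_linear_simps[OF assms(1)] sf.subspace_add sf.subspace_scale)
qed


section \<open>Length and parity\<close>

text \<open>Fixing the parity lets a creation mode raise the level by one and an annihilation mode
  lower it by one, and keeps the odd levels inside \<open>sf_minus\<close>.\<close>

definition sf_filt :: "nat \<Rightarrow> sf set" where
  "sf_filt r = sf.span {sf_mono hs | hs.
     sf_pos hs \<and> length hs \<le> r \<and> even (length hs) = even r}"

text \<open>The boolean index, true for even, allows both modules to be treated at once.\<close>

definition sf_par :: "bool \<Rightarrow> sf set" where
  "sf_par b = sf.span {sf_mono hs | hs. sf_pos hs \<and> even (length hs) = b}"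

lemma sf_par_simps: "sf_par True = sf_plus" "sf_par False = sf_minus"
  by (simp_all add: sf_par_def sf_plus_def sf_minus_def)

lemma sf_filt_subspace: "sf.subspace (sf_filt r)"
  unfolding sf_filt_def by simp

lemma sf_par_subspace: "sf.subspace (sf_par b)"
  unfolding sf_par_def by simp

lemma sf_mono_filt:
  "sf_pos hs \<Longrightarrow> length hs \<le> r \<Longrightarrow> even (length hs) = even r \<Longrightarrow> sf_mono hs \<in> sf_filt r"
  unfolding sf_filt_def by (rule sf.span_base) blast

lemma sf_filt_mono: "r \<le> s \<Longrightarrow> even r = even s \<Longrightarrow> sf_filt r \<subseteq> sf_filt s"
  unfolding sf_filt_def by (rule sf.span_mono) auto

lemma sf_filt_par: "sf_filt r \<subseteq> sf_par (even r)"
  unfolding sf_filt_def sf_par_def by (rule sf.span_mono) auto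

lemma sf_act_neg_filt:
  assumes "n < 0" "u \<in> sf_filt r"
  shows "sf_act h n u \<in> sf_filt (Suc r)"
  using assms(2) unfolding sf_filt_def[of r]
proof (rule sf_linear_span_subset[OF sf_act_linear sf_filt_subspace, rotated])
  fix b assume "b \<in> {sf_mono hs | hs. sf_pos hs \<and> length hs \<le> r \<and> even (length hs) = even r}"
  then obtain hs where hs: "b = sf_mono hs" "sf_pos hs" "length hs \<le> r" "even (length hs) = even r"
    by blast
  have "sf_mono ((h, nat (- n)) # hs) \<in> sf_filt (Suc r)"
    using assms(1) hs by (intro sf_mono_filt) (auto simp: sf_pos_def)
  then show "sf_act h n b \<in> sf_filt (Suc r)" using assms(1) hs by simp
qed

text \<open>Anticommuted to the right, \<open>h_(n)\<close> either contracts with a factor, which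
  removes that factor, or reaches the vacuum and kills it.\<close>

lemma sf_act_nonneg_mono:
  assumes "n \<ge> 0" "sf_pos hs"
  shows "sf_act h n (sf_mono hs) \<in> sf_filt (length hs - 1)"
  using assms(2)
proof (induction hs)
  case Nil
  then show ?case using sf_act_vac[OF assms(1)] sf_filt_subspace by (simp add: sf.subspace_0)
next
  case (Cons p hs)
  obtain h' m where p: "p = (h', m)" by (cases p)
  have hs: "sf_pos hs" "m > 0" using Cons.prems by (auto simp: sf_pos_def p)
  let ?w = "sf_mono hs"
  have w: "?w \<in> sf_filt (length hs)" using hs by (intro sf_mono_filt) auto
  \<comment> \<open>For empty \<open>hs\<close> the index \<open>length hs - 1\<close> truncates to
    0, and the induction hypothesis would lead to the wrong parity; there the vacuum is killed
    directly.\<close>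
  have *: "sf_act h' (- int m) (sf_act h n ?w) \<in> sf_filt (length hs)"
  proof (cases hs)
    case Nil
    then show ?thesis using sf_act_vac[OF assms(1)] sf_filt_subspace
      by (simp add: sf.subspace_0 sf_act_simps)
  next
    case (Cons q qs)
    then show ?thesis
      using sf_act_neg_filt[of "- int m" _ "length hs - 1"] Cons.IH hs by simp
  qed
  have "sf_act h n (sf_act h' (- int m) ?w) =
      (if n + - int m = 0 then of_int n * sf_form h h' else 0) *\<^sub>T ?w
        - sf_act h' (- int m) (sf_act h n ?w)"
    using sf_act_anticommute[of h n h' "- int m" ?w] by (simp only: eq_diff_eq)
  also have "\<dots> \<in> sf_filt (length hs)"
    using w * sf_filt_subspace by (intro sf.subspace_diff sf.subspace_scale) auto
  finally show ?case by (simp add: p)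
qed

lemma sf_act_nonneg_filt:
  assumes "n \<ge> 0" "u \<in> sf_filt (Suc r)"
  shows "sf_act h n u \<in> sf_filt r"
  using assms(2) unfolding sf_filt_def[of "Suc r"]
proof (rule sf_linear_span_subset[OF sf_act_linear sf_filt_subspace, rotated])
  fix b assume "b \<in> {sf_mono hs | hs. sf_pos hs \<and> length hs \<le> Suc r \<and> even (length hs) = even (Suc r)}"
  then obtain hs where hs: "b = sf_mono hs" "sf_pos hs" "length hs \<le> Suc r"
    "even (length hs) = even (Suc r)"
    by blast
  show "sf_act h n b \<in> sf_filt r"
  proof (cases hs)
    case Nil
    then show ?thesis using hs sf_act_vac[OF assms(1)] sf_filt_subspace by (simp add: sf.subspace_0)
  next
    case (Cons q qs)
    then have "sf_filt (length hs - 1) \<subseteq> sf_filt r"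
      using hs by (intro sf_filt_mono) auto
    then show ?thesis using sf_act_nonneg_mono[OF assms(1) hs(2), of h] hs(1) by auto
  qed
qed

lemma sf_act_par:
  assumes "u \<in> sf_par b"
  shows "sf_act h n u \<in> sf_par (\<not> b)"
  using assms unfolding sf_par_def[of b]
proof (rule sf_linear_span_subset[OF sf_act_linear sf_par_subspace, rotated])
  fix v assume "v \<in> {sf_mono hs | hs. sf_pos hs \<and> even (length hs) = b}"
  then obtain hs where hs: "v = sf_mono hs" "sf_pos hs" "even (length hs) = b"
    by blast
  have v: "v \<in> sf_filt (length hs)" using hs by (auto intro: sf_mono_filt)
  show "sf_act h n v \<in> sf_par (\<not> b)"
  proof (cases "n < 0")
    case True
    then show ?thesis
      using sf_act_neg_filt[OF True v, of h] sf_filt_par[of "Suc (length hs)"] hs(3) by auto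
  next
    case False
    show ?thesis
    proof (cases hs)
      case Nil
      then show ?thesis using hs sf_act_vac False sf_par_subspace by (simp add: sf.subspace_0)
    next
      case (Cons q qs)
      then have "sf_act h n v \<in> sf_filt (length qs)"
        using sf_act_nonneg_filt[of n v "length qs" h] False v by simp
      then show ?thesis using sf_filt_par[of "length qs"] hs(3) Cons by auto
    qed
  qed
qed

text \<open>Every mode flips the parity, wherever normal ordering places it. Equality of booleans
  serves as addition of parities.\<close>

lemma sf_normal_par:
  "u \<in> sf_par b \<Longrightarrow> sf_normal hs u \<in> sf_par (b = even (length hs))"
proof (induction hs arbitrary: u b)
  case Nil
  then show ?case by simp
next
  case (Cons p hs)
  obtain h m where p: "p = (h, m)" by (cases p)
  have "sf_act h m (sf_normal hs u) \<in> sf_par (\<not> (b = even (length hs)))"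
    by (rule sf_act_par[OF Cons.IH[OF Cons.prems]])
  moreover have "sf_normal hs (sf_act h m u) \<in> sf_par ((\<not> b) = even (length hs))"
    by (rule Cons.IH[OF sf_act_par[OF Cons.prems]])
  ultimately show ?case
    using sf.subspace_scale[OF sf_par_subspace] by (cases b) (simp_all add: p)
qed

lemma sf_Y_par:
  assumes "v \<in> sf_plus" "u \<in> sf_par b"
  shows "sf_Y v k u \<in> sf_par b"
  using assms(1) unfolding sf_plus_def
proof (rule sf_linear_span_subset[OF sf_Y_linear_left sf_par_subspace, rotated])
  fix v assume "v \<in> {sf_mono hs | hs. sf_pos hs \<and> even (length hs)}"
  then obtain hs where hs: "v = sf_mono hs" "sf_pos hs" "even (length hs)" by blast
  have "sf_field hs k u \<in> sf_par b"
    unfolding sf_field_def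
  proof (rule sf_Sum_any_in_subspace[OF sf_par_subspace])
    fix ms
    show "(if sf_field_index hs k ms then sf_field_term hs ms u else 0) \<in> sf_par b"
      using sf_normal_par[OF assms(2), of "zip (map fst hs) ms"] hs(3)
      by (auto simp: sf_field_index_def sf_field_term_def
          intro: sf.subspace_scale[OF sf_par_subspace] sf.subspace_0[OF sf_par_subspace])
  qed
  then show "sf_Y v k u \<in> sf_par b" using hs by (simp add: sf_Y_mono)
qed

section \<open>The three products and the bimodule of all classes\<close>

lemma sf_mono_weight: "sf_pos hs \<Longrightarrow> sf_mono hs \<in> sf_weight (sum_list (map snd hs))"
  unfolding sf_weight_def by (rule sf.span_base) blast

text \<open>By linearity in \<open>a\<close> monomials suffice. These are homogeneous, so each
  product is a combination of vectors \<open>a_(k) u\<close>, and even \<open>a\<close> keeps the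
  parity of \<open>u\<close>.\<close>

lemma sf_products_par:
  assumes "a \<in> sf_plus" "u \<in> sf_par b"
  shows "sf_circ a u \<in> sf_par b" and "sf_left a u \<in> sf_par b" and "sf_right u a \<in> sf_par b"
proof -
  have lin: "sf_linear (\<lambda>a. sf_circ a u)" "sf_linear (\<lambda>a. sf_left a u)" "sf_linear (sf_right u)"
    unfolding sf_circ_def sf_left_def sf_right_def by (rule sf_ext_lin)+
  have *: "sf_circ v u \<in> sf_par b \<and> sf_left v u \<in> sf_par b \<and> sf_right u v \<in> sf_par b"
    if v: "v \<in> {sf_mono hs | hs. sf_pos hs \<and> even (length hs)}" for v
  proof -
    obtain hs where hs: "v = sf_mono hs" "sf_pos hs" using v by blast
    have "v \<in> sf_plus" unfolding sf_plus_def by (rule sf.span_base[OF v])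
    note Y = sf_Y_par[OF this assms(2)]
    show ?thesis
      unfolding hs(1) sf_products_homogeneous[OF sf_mono_weight[OF hs(2)]]
      unfolding sf_circ_hom_def sf_left_hom_def sf_right_hom_def
      by (intro conjI sf_Sum_any_in_subspace sf.subspace_scale sf_par_subspace)
        (simp_all add: Y flip: hs(1))
  qed
  show "sf_circ a u \<in> sf_par b" "sf_left a u \<in> sf_par b" "sf_right u a \<in> sf_par b"
    by (rule lin[THEN sf_linear_span_subset, OF sf_par_subspace _ assms(1)[unfolded sf_plus_def]];
      use * in blast)+
qed

lemma zhu_O_subset: "zhu_O (sf_par b) \<subseteq> sf_par b"
  unfolding zhu_O_def
  by (rule sf.span_minimal) (auto intro: sf_products_par sf_par_subspace)

lemma zhu_class_self: "u \<in> zhu_class M u"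
  unfolding zhu_class_def zhu_O_def using sf.span_zero by force

lemma zhu_A_par:
  assumes "U \<in> zhu_A (sf_par b)" "u \<in> U"
  shows "u \<in> sf_par b"
  using assms zhu_O_subset[of b] sf.subspace_add[OF sf_par_subspace[of b]]
  unfolding zhu_A_def zhu_class_def by blast

text \<open>Closure only asks that results computed from representatives have their class in the
  set, so preservation of parity is all there is to check.\<close>

lemma zhu_A_subbimodule: "zhu_subbimodule (sf_par b) (zhu_A (sf_par b))"
proof -
  have cl: "zhu_class (sf_par b) u \<in> zhu_A (sf_par b)" if "u \<in> sf_par b" for u
    using that by (simp add: zhu_A_def)
  show ?thesis
    unfolding zhu_subbimodule_def
    using zhu_A_par[of _ b] zhu_A_par[of _ True, unfolded sf_par_simps]
    by (auto intro!: cl sf.subspace_0 sf.subspace_add sf.subspace_scale sf_par_subspace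
        sf_products_par)
qed


section \<open>Quadratic elements\<close>

lemma sf_field_pair_index:
  "sf_field_index [(x, m), (y, n)] k ms \<longleftrightarrow>
    (\<exists>p q. ms = [p, q] \<and> p + q + int m + int n = k + 1)"
  by (auto simp: sf_field_index_def length_Suc_conv numeral_2_eq_2)

text \<open>The falling factorial passes through zero. For the coefficient of \<open>x_(p)\<close>
  in the divided derivative of order \<open>m - 1\<close>, this removes the modes with
  \<open>-m < p < 0\<close>.\<close>

lemma gbinomial_of_int_zero:
  assumes "0 \<le> i" "i < int k"
  shows "(of_int i :: complex) gchoose k = 0"
proof -
  have "(of_int i :: complex) = of_nat (nat i)" using assms by simp
  then show ?thesis using assms by (simp only: flip: binomial_gbinomial) (simp add: nat_less_iff)
qed

lemma gbinomial_of_nat_self: "(of_nat k :: complex) gchoose k = 1"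
  by (simp flip: binomial_gbinomial)

text \<open>If both modes create, the bound on \<open>p + q\<close> puts one of them strictly above
  \<open>-m\<close> or \<open>-n\<close>, and its binomial coefficient vanishes. Otherwise at least
  one mode annihilates, and the length cannot grow.\<close>

lemma sf_field_pair_term:
  assumes u: "u \<in> sf_filt (Suc r)" and pos: "0 < m" "0 < n"
    and pq: "p + q + int m + int n \<ge> 0" "\<not> (p = - int m \<and> q = - int n)"
  shows "sf_field_term [(x, m), (y, n)] [p, q] u \<in> sf_filt (Suc r)"
proof (cases "p < 0 \<and> q < 0")
  case True
  then have "p > - int m \<or> q > - int n" using pq by auto
  then have "(of_int (- p - 1) :: complex) gchoose (m - 1) = 0
      \<or> (of_int (- q - 1) :: complex) gchoose (n - 1) = 0"
    using True pos gbinomial_of_int_zero[of "- p - 1" "m - 1"]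
      gbinomial_of_int_zero[of "- q - 1" "n - 1"] by linarith
  then show ?thesis
    by (auto simp: sf_field_term_def sf.subspace_0[OF sf_filt_subspace])
next
  case False
  have "sf_normal [(x, p), (y, q)] u \<in> sf_filt (Suc r)"
  proof (cases "p < 0")
    case True
    then show ?thesis
      using False sf_act_neg_filt[OF True sf_act_nonneg_filt[OF _ u, of q y], of x] by simp
  next
    case p: False
    have "sf_act x p u \<in> sf_filt r" using p by (intro sf_act_nonneg_filt[OF _ u]) simp
    moreover have "sf_act y q w \<in> sf_filt (Suc r)" if w: "w \<in> sf_filt r" for w
    proof (cases "q < 0")
      case True
      then show ?thesis using sf_act_neg_filt[OF True w] by simp
    next
      case False
      \<comment> \<open>Both modes annihilate here; embedding \<open>w\<close> two levels up makes
        the lowering by one end at level \<open>Suc r\<close>.\<close>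
      have "w \<in> sf_filt (Suc (Suc r))" using w sf_filt_mono[of r "Suc (Suc r)"] by auto
      then show ?thesis using False by (intro sf_act_nonneg_filt) auto
    qed
    ultimately show ?thesis
      using p sf.subspace_scale[OF sf_filt_subspace] by (simp add: sf_act_simps sf.subspace_neg[OF sf_filt_subspace])
  qed
  then show ?thesis
    unfolding sf_field_term_def
    by (simp only: list.map fst_conv zip_Cons_Cons zip_Nil sf.subspace_scale[OF sf_filt_subspace])
qed

text \<open>The summand \<open>i = 0\<close> is \<open>a_(-1) u\<close>, in which the mode pair
  \<open>(-m, -n)\<close> has coefficient 1 and gives the leading term. Everything else falls under
  \<open>sf_field_pair_term\<close>, since \<open>k >= -1\<close> means
  \<open>p + q >= -m - n\<close>.\<close>

lemma sf_left_pair_leading: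
  assumes u: "u \<in> sf_filt (Suc r)" and pos: "0 < m" "0 < n"
  shows "sf_left (sf_mono [(x, m), (y, n)]) u - sf_act x (- int m) (sf_act y (- int n) u)
      \<in> sf_filt (Suc r)"
proof -
  let ?hs = "[(x, m), (y, n)]" and ?v = "sf_act x (- int m) (sf_act y (- int n) u)"
  let ?W = "sf_filt (Suc r)" and ?d = "m + n"
  have hs: "sf_pos ?hs" using pos by (simp add: sf_pos_def)
  let ?t = "\<lambda>k ms. if sf_field_index ?hs k ms then sf_field_term ?hs ms u else 0"
  have t: "?t k ms \<in> ?W" if "k \<ge> - 1" "ms \<noteq> [- int m, - int n]" for k ms
  proof (cases "sf_field_index ?hs k ms")
    case True
    then obtain p q where "ms = [p, q]" "p + q + int m + int n = k + 1"
      unfolding sf_field_pair_index by blast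
    then show ?thesis
      using True that sf_field_pair_term[OF u pos, of p q] by simp
  next
    case False
    then show ?thesis by (simp add: sf.subspace_0[OF sf_filt_subspace])
  qed
  have lead: "?t (- 1) [- int m, - int n] = ?v"
  proof -
    have "(of_int (- (- int j) - 1) :: complex) gchoose (j - 1) = 1" if "0 < j" for j
    proof -
      have "(of_int (- (- int j) - 1) :: complex) = of_nat (j - 1)"
        using that by (simp add: of_nat_diff)
      then show ?thesis by (simp only: gbinomial_of_nat_self)
    qed
    from this[OF pos(1)] this[OF pos(2)] show ?thesis
      using pos by (simp add: sf_field_pair_index sf_field_term_def)
  qed
  have "sf_Y (sf_mono ?hs) (- 1) u - ?v \<in> ?W"
    unfolding sf_Y_mono[OF hs] sf_field_def
  proof (rule sf_Sum_any_leading[OF sf_filt_subspace sf_field_support])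
    show "?t (- 1) [- int m, - int n] - ?v \<in> ?W"
      unfolding lead by (simp add: sf.subspace_0[OF sf_filt_subspace])
  qed (rule t, simp_all)
  \<comment> \<open>The pair \<open>(-m, -n)\<close> would force \<open>k = -1\<close>, so it does
    not occur in these coefficients.\<close>
  moreover have "sf_Y (sf_mono ?hs) k u \<in> ?W" if "k \<ge> 0" for k
    unfolding sf_Y_mono[OF hs] sf_field_def
  proof (rule sf_Sum_any_in_subspace[OF sf_filt_subspace])
    fix ms
    show "?t k ms \<in> ?W"
    proof (cases "ms = [- int m, - int n]")
      case True
      then show ?thesis using that
        by (simp add: sf_field_pair_index sf.subspace_0[OF sf_filt_subspace])
    next
      case False
      then show ?thesis using that by (intro t) auto
    qed
  qed
  ultimately have "sf_left_hom ?d (sf_mono ?hs) u - ?v \<in> ?W"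
    unfolding sf_left_hom_def
    by (intro sf_Sum_any_leading[where j = 0] sf_filt_subspace sf_product_finite)
      (simp_all add: sf.subspace_scale[OF sf_filt_subspace])
  then show ?thesis
    using sf_products_homogeneous(2)[OF sf_mono_weight[OF hs], of u] by simp
qed

section \<open>Commutators of the left and right actions\<close>

text \<open>Pascal's rule followed by an index shift; the summands for \<open>i = 0\<close> cancel.
  Positive weight makes the upper index of the right product the natural number
  \<open>d\<close>.\<close>

lemma sf_left_minus_right:
  assumes "a \<in> sf_weight (Suc d)"
  shows "sf_left a u - sf_right u a = Sum_any (\<lambda>i. of_nat (d choose i) *\<^sub>T sf_Y a (int i) u)"
proof -
  let ?g = "\<lambda>i::nat. of_nat (d choose i) *\<^sub>T sf_Y a (int i) u"
  let ?h = "\<lambda>i::nat. of_nat (Suc d choose i) *\<^sub>T sf_Y a (int i - 1) u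
      - ((of_nat (Suc d) - 1) gchoose i) *\<^sub>T sf_Y a (int i - 1) u"
  have "sf_left a u - sf_right u a = Sum_any ?h"
    unfolding sf_products_homogeneous[OF assms] sf_left_hom_def sf_right_hom_def
    by (rule sf_Sum_any_diff[OF sf_product_finite sf_product_finite])
  also have "?h = (\<lambda>i. case i of 0 \<Rightarrow> 0 | Suc i \<Rightarrow> ?g i)"
  proof
    fix i
    have "of_nat (Suc d) - 1 = (of_nat d :: complex)" by simp
    then show "?h i = (case i of 0 \<Rightarrow> 0 | Suc i \<Rightarrow> ?g i)"
      by (simp only: flip: binomial_gbinomial)
        (simp add: sf.scale_left_distrib split: nat.split)
  qed
  also have "Sum_any \<dots> = Sum_any ?g"
  proof -
    have "{i. (case i of 0 \<Rightarrow> 0 | Suc i \<Rightarrow> g i) \<noteq> 0} = Suc ` {i. g i \<noteq> 0}" for g :: "nat \<Rightarrow> sf"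
      by (auto split: nat.splits simp: image_iff) (metis Suc_pred)
    then show ?thesis
      unfolding Sum_any.expand_set by (simp only:) (subst sum.reindex, auto)
  qed
  finally show ?thesis .
qed

text \<open>On \<open>x_(-1)|0>\<close> all \<open>x_(p)\<close> with \<open>p >= 0\<close> vanish
  because \<open><x,x> = 0\<close>, and among the \<open>y_(q)\<close> with \<open>q >= 0\<close>
  only \<open>q = 1\<close> survives, contracting to \<open><y,x>|0>\<close>. So one mode pair
  remains.\<close>

lemma sf_Y_pair_single:
  assumes "0 < m" "sf_form x x = 0"
  shows "sf_Y (sf_mono [(x, m), (y, 1)]) (int k) (sf_act x (- 1) sf_vac) =
    (((of_int (int m - int k) :: complex) gchoose (m - 1)) * sf_form y x)
      *\<^sub>T sf_act x (int k - int m - 1) sf_vac"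
proof -
  let ?hs = "[(x, m), (y, 1)]" and ?u = "sf_act x (- 1) sf_vac"
  let ?c = "(of_int (int m - int k) :: complex) gchoose (m - 1)"
  have hs: "sf_pos ?hs" using assms by (simp add: sf_pos_def)
  have x: "sf_act x p ?u = 0" if "p \<ge> 0" for p
    using sf_act_anticommute[of x p x "- 1" sf_vac] sf_act_vac[OF that] assms(2)
    by (simp add: sf_act_simps)
  have y: "sf_act y q ?u = (if q = 1 then sf_form y x else 0) *\<^sub>T sf_vac" if "q \<ge> 0" for q
    using sf_act_anticommute[of y q x "- 1" sf_vac] sf_act_vac[OF that]
    by (simp add: sf_act_simps split: if_splits)
  let ?t = "\<lambda>ms. if sf_field_index ?hs (int k) ms then sf_field_term ?hs ms ?u else 0"
  have t: "?t [p, q] = (if q = 1 then (?c * sf_form y x) *\<^sub>T sf_act x p sf_vac else 0)"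
    if i: "p + q = int k - int m" for p q
  proof -
    have idx: "sf_field_index ?hs (int k) [p, q]" using i by (simp add: sf_field_pair_index)
    consider "p < 0" "q < 0" | "p \<ge> 0" | "p < 0" "q \<ge> 0" by linarith
    then show ?thesis
    proof cases
      case 1
      \<comment> \<open>\<open>q <= -1\<close> gives \<open>p >= k - m + 1 > -m\<close>, so the
        coefficient of \<open>x_(p)\<close> vanishes.\<close>
      then have "(of_int (- p - 1) :: complex) gchoose (m - 1) = 0"
        using i assms(1) by (intro gbinomial_of_int_zero) auto
      then show ?thesis using idx 1 by (simp add: sf_field_term_def)
    next
      case 2
      \<comment> \<open>This includes \<open>q = 1\<close> with \<open>k > m\<close>, where the
        claimed value is zero as well because \<open>x_(p)\<close> kills the vacuum.\<close>
      then show ?thesis using idx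
        by (auto simp: sf_field_term_def x sf_act_vac sf_act_simps)
    next
      case 3
      have "- p - 1 = int m - int k" if "q = 1" using that i by simp
      then show ?thesis using idx 3
        by (auto simp: sf_field_term_def y sf_act_simps simp del: of_int_diff of_int_minus)
    qed
  qed
  have "sf_field ?hs (int k) ?u = ?t [int k - int m - 1, 1]"
    unfolding sf_field_def
  proof (rule sf_Sum_any_single)
    fix ms assume ms: "ms \<noteq> [int k - int m - 1, 1]"
    show "?t ms = 0"
    proof (cases "sf_field_index ?hs (int k) ms")
      case True
      then obtain p q where pq: "ms = [p, q]" "p + q + int m + int 1 = int k + 1"
        unfolding sf_field_pair_index by blast
      then have "q \<noteq> 1" "p + q = int k - int m" using ms by auto
      then show ?thesis using t[of p q] unfolding pq(1) by simp
    qed simp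
  qed
  then show ?thesis using t[of "int k - int m - 1" 1] unfolding sf_Y_mono[OF hs] by simp
qed

text \<open>The quadratic element has weight \<open>m + 1\<close>, so the commutator sum carries
  \<open>m choose i\<close>. Only \<open>i = 0\<close> and \<open>i = 1\<close> survive, each with
  total coefficient \<open>m <y,x>\<close>.\<close>

lemma sf_left_minus_right_single:
  assumes "0 < m" "sf_form x x = 0"
  shows "sf_left (sf_mono [(x, m), (y, 1)]) (sf_act x (- 1) sf_vac)
      - sf_right (sf_act x (- 1) sf_vac) (sf_mono [(x, m), (y, 1)])
    = (of_nat m * sf_form y x) *\<^sub>T (sf_mono [(x, Suc m)] + sf_mono [(x, m)])"
proof -
  let ?a = "sf_mono [(x, m), (y, 1)]" and ?u = "sf_act x (- 1) sf_vac"
  let ?g = "\<lambda>i. of_nat (m choose i) *\<^sub>T sf_Y ?a (int i) ?u"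
  have pos: "sf_pos [(x, m), (y, 1)]" using assms(1) by (simp add: sf_pos_def)
  have wt: "?a \<in> sf_weight (Suc m)"
    using sf_mono_weight[OF pos] by simp
  have g: "?g i = (of_nat (m choose i) * (((of_int (int m - int i) :: complex) gchoose (m - 1)) * sf_form y x))
      *\<^sub>T sf_act x (int i - int m - 1) sf_vac" for i
    unfolding sf_Y_pair_single[OF assms] by simp
  \<comment> \<open>For \<open>2 <= i <= m\<close> the upper index \<open>m - i\<close> lies between
    0 and \<open>m - 2\<close>; for \<open>i > m\<close> it is negative, but then
    \<open>m choose i\<close> vanishes.\<close>
  have "(of_int (int m - int i) :: complex) gchoose (m - 1) = 0" if "2 \<le> i" "i \<le> m" for i
    using that by (intro gbinomial_of_int_zero) auto
  then have "?g i = 0" if "2 \<le> i" for i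
    unfolding g using that by (cases "i \<le> m") (auto simp: binomial_eq_0)
  then have "{i. ?g i \<noteq> 0} \<subseteq> {..<2}"
    by (metis (mono_tags, lifting) lessThan_iff linorder_not_less mem_Collect_eq subsetI)
  moreover have "{..<2} = {0, 1 :: nat}" by auto
  ultimately have "Sum_any ?g = sum ?g {0, 1}"
    by (intro Sum_any.expand_superset) simp_all
  also have "\<dots> = ?g 0 + ?g 1" by simp
  also have "?g 0 = (of_nat m * sf_form y x) *\<^sub>T sf_mono [(x, Suc m)]"
  proof -
    have "(of_int (int m - int 0) :: complex) gchoose (m - 1) = of_nat m"
      using assms(1) by (cases m) (simp_all flip: binomial_gbinomial of_nat_Suc)
    moreover have "int 0 - int m - 1 = - int (Suc m)" by simp
    then have "sf_act x (int 0 - int m - 1) sf_vac = sf_mono [(x, Suc m)]"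
      by (simp only: sf_mono_simps)
    ultimately show ?thesis unfolding g by (simp only: binomial_n_0 of_nat_1 mult_1)
  qed
  also have "?g 1 = (of_nat m * sf_form y x) *\<^sub>T sf_mono [(x, m)]"
  proof -
    have "(of_int (int m - int 1) :: complex) = of_nat (m - 1)"
      using assms(1) by (simp add: of_nat_diff)
    then have "(of_int (int m - int 1) :: complex) gchoose (m - 1) = 1"
      by (simp only: gbinomial_of_nat_self)
    then show ?thesis unfolding g by simp
  qed
  finally show ?thesis
    unfolding sf_left_minus_right[OF wt] by (simp add: sf.scale_right_distrib)
qed

section \<open>Generation by \<open>e\<close> and \<open>f\<close>\<close>

text \<open>Stated for a subspace of vectors so that no quotient is involved; \<open>W\<close> will
  be the preimage of a sub-bimodule. Commutators yield the vectors with one mode, leading terms of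
  the left action the longer ones.\<close>

lemma sf_minus_generated:
  assumes W: "sf.subspace W"
    and e: "sf_act sf_e (- 1) sf_vac \<in> W" and f: "sf_act sf_f (- 1) sf_vac \<in> W"
    and left: "\<And>a u. a \<in> sf_plus \<Longrightarrow> u \<in> W \<Longrightarrow> sf_left a u \<in> W"
    and right: "\<And>a u. a \<in> sf_plus \<Longrightarrow> u \<in> W \<Longrightarrow> sf_right u a \<in> W"
  shows "sf_minus \<subseteq> W"
proof -
  have pair: "sf_mono [(x, m), (y, n)] \<in> sf_plus" if "0 < m" "0 < n" for x y m n
  proof -
    have "sf_pos [(x, m), (y, n)] \<and> even (length [(x, m), (y, n)])"
      using that by (simp add: sf_pos_def)
    then show ?thesis unfolding sf_plus_def by (intro sf.span_base) blast
  qed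
  \<comment> \<open>The partner \<open>y\<close> will be \<open>f\<close> for \<open>e\<close> and
    \<open>e\<close> for \<open>f\<close>. The commutator puts the sum of \<open>x_(-m-2)|0>\<close>
    and \<open>x_(-m-1)|0>\<close> into \<open>W\<close>, and the second vector is there by
    induction.\<close>
  have single: "sf_mono [(x, Suc m)] \<in> W"
    if u: "sf_act x (- 1) sf_vac \<in> W" and x: "sf_form x x = 0" "sf_form y x \<noteq> 0" for x y m
  proof (induction m)
    case 0
    show ?case using u by simp
  next
    case (Suc m)
    let ?c = "of_nat (Suc m) * sf_form y x" and ?b = "sf_mono [(x, Suc m)]"
    let ?v = "sf_mono [(x, Suc (Suc m))]"
    have a: "sf_mono [(x, Suc m), (y, 1)] \<in> sf_plus" by (rule pair) auto
    have "?c *\<^sub>T (?v + ?b) \<in> W"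
      unfolding sf_left_minus_right_single[OF zero_less_Suc x(1), symmetric]
      by (intro sf.subspace_diff[OF W] left right a u)
    then have "inverse ?c *\<^sub>T ?c *\<^sub>T (?v + ?b) \<in> W"
      by (rule sf.subspace_scale[OF W])
    moreover have c: "?c \<noteq> 0" using x(2) by (simp del: of_nat_Suc)
    have "inverse ?c *\<^sub>T ?c *\<^sub>T (?v + ?b) = ?v + ?b"
      by (simp only: sf.scale_scale left_inverse[OF c] sf.scale_one)
    ultimately have "?v + ?b \<in> W" by (simp only:)
    from sf.subspace_diff[OF W this Suc.IH] show ?case by (simp only: add_diff_cancel_right')
  qed
  have one: "sf_mono [(h, n)] \<in> W" if "0 < n" for h n
  proof -
    obtain m where n: "n = Suc m" using \<open>0 < n\<close> gr0_implies_Suc by blast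
    have form: "sf_form sf_e sf_e = 0" "sf_form sf_f sf_e \<noteq> 0"
      "sf_form sf_f sf_f = 0" "sf_form sf_e sf_f \<noteq> 0"
      by (simp_all add: sf_form_def sf_e_def sf_f_def)
    have "sf_mono [(sf_e, n)] \<in> W" "sf_mono [(sf_f, n)] \<in> W"
      unfolding n by (rule single[OF e form(1,2)], rule single[OF f form(3,4)])
    then have "fst h *\<^sub>T sf_mono [(sf_e, n)] + snd h *\<^sub>T sf_mono [(sf_f, n)] \<in> W"
      by (intro sf.subspace_add[OF W] sf.subspace_scale[OF W])
    then show ?thesis
      using sf_act_linear_left[of "fst h" sf_e "snd h" sf_f "- int n" sf_vac]
      by (simp add: sf_e_def sf_f_def)
  qed
  \<comment> \<open>Levels rise by two because a quadratic element adds two modes; the error of its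
    leading term stays on the previous odd level.\<close>
  have filt: "sf_filt (Suc (2 * s)) \<subseteq> W" for s
  proof (induction s)
    case 0
    have "sf_mono hs \<in> W" if "sf_pos hs" "length hs \<le> 1" "odd (length hs)" for hs
    proof -
      have "length hs = 1" using that by (cases "length hs") auto
      then show ?thesis using that one by (auto simp: length_Suc_conv sf_pos_def simp del: sf_mono_simps)
    qed
    then show ?case unfolding sf_filt_def by (intro sf.span_minimal W) auto
  next
    case (Suc s)
    have "sf_mono hs \<in> W" if hs: "sf_pos hs" "length hs \<le> Suc (2 * Suc s)" "odd (length hs)" for hs
    proof (cases "length hs \<le> 1")
      case True
      then have "sf_mono hs \<in> sf_filt (Suc (2 * s))" using hs by (intro sf_mono_filt) auto
      then show ?thesis using Suc by blast
    next
      case False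
      then obtain x m y n hs' where hs': "hs = (x, m) # (y, n) # hs'"
        by (cases hs; cases "tl hs") auto
      have pos: "0 < m" "0 < n" using hs(1) by (auto simp: hs' sf_pos_def)
      have u: "sf_mono hs' \<in> sf_filt (Suc (2 * s))"
        using hs by (intro sf_mono_filt) (auto simp: hs' sf_pos_def)
      have "sf_left (sf_mono [(x, m), (y, n)]) (sf_mono hs') \<in> W"
        using Suc u pair[OF pos] by (intro left) auto
      moreover have "sf_left (sf_mono [(x, m), (y, n)]) (sf_mono hs') - sf_mono hs \<in> W"
        using sf_left_pair_leading[OF u pos, of x y] Suc by (auto simp: hs')
      ultimately show ?thesis using sf.subspace_diff[OF W] by fastforce
    qed
    then show ?case unfolding sf_filt_def by (intro sf.span_minimal W) auto
  qed
  have "sf_mono hs \<in> W" if hs: "sf_pos hs" "odd (length hs)" for hs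
  proof -
    obtain s where "length hs = Suc (2 * s)" using hs(2) by (auto elim: oddE)
    then show ?thesis using filt[of s] sf_mono_filt[of hs "Suc (2 * s)"] hs by auto
  qed
  then show ?thesis unfolding sf_minus_def by (intro sf.span_minimal W) auto
qed

theorem proposition4p1:
  shows "zhu_generated sf_minus
           {zhu_class sf_minus (sf_act sf_e (- 1) sf_vac),
            zhu_class sf_minus (sf_act sf_f (- 1) sf_vac)}
         = zhu_A sf_minus"
proof
  let ?M = sf_minus
  have ef: "sf_act h (- 1) sf_vac \<in> ?M" for h
    using sf_act_par[of sf_vac True h "- 1"] sf_mono_filt[of "[]" 0] sf_filt_par[of 0]
    by (auto simp: sf_par_simps sf_pos_def)
  show "zhu_generated ?M {zhu_class ?M (sf_act sf_e (- 1) sf_vac),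
      zhu_class ?M (sf_act sf_f (- 1) sf_vac)} \<subseteq> zhu_A ?M"
    unfolding zhu_generated_def
  \<comment> \<open>The set of all classes is itself one of the intersected sub-bimodules.\<close>
  proof (rule Inter_lower, intro CollectI conjI)
    show "zhu_subbimodule ?M (zhu_A ?M)"
      using zhu_A_subbimodule[of False] by (simp only: sf_par_simps)
  qed (use ef in \<open>simp add: zhu_A_def\<close>)
  show "zhu_A ?M \<subseteq> zhu_generated ?M {zhu_class ?M (sf_act sf_e (- 1) sf_vac),
      zhu_class ?M (sf_act sf_f (- 1) sf_vac)}"
    unfolding zhu_generated_def
  proof (rule Inter_greatest)
    fix N
    assume "N \<in> {N. zhu_subbimodule ?M N \<and> {zhu_class ?M (sf_act sf_e (- 1) sf_vac),
      zhu_class ?M (sf_act sf_f (- 1) sf_vac)} \<subseteq> N}"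
    then have N: "zhu_subbimodule ?M N" and gen: "zhu_class ?M (sf_act sf_e (- 1) sf_vac) \<in> N"
      "zhu_class ?M (sf_act sf_f (- 1) sf_vac) \<in> N"
      by auto
    note N' = N[unfolded zhu_subbimodule_def]
    have zero: "zhu_class ?M 0 \<in> N" using N' by (elim conjE)
    \<comment> \<open>Closure speaks of all representatives; \<open>zhu_class_self\<close> provides
      \<open>u\<close> and \<open>w\<close> as representatives of their own classes.\<close>
    have add: "zhu_class ?M (u + w) \<in> N" if "zhu_class ?M u \<in> N" "zhu_class ?M w \<in> N" for u w
      using N' that zhu_class_self[of u ?M] zhu_class_self[of w ?M] by (elim conjE) (drule (1) bspec)+
    have scale: "zhu_class ?M (c *\<^sub>T u) \<in> N" if "zhu_class ?M u \<in> N" for c u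
      using N' that zhu_class_self[of u ?M] by (elim conjE) metis
    have act: "zhu_class ?M (sf_left a u) \<in> N \<and> zhu_class ?M (sf_right u a) \<in> N"
      if "a \<in> sf_plus" "zhu_class ?M u \<in> N" for a u
    proof -
      have "zhu_class sf_plus a \<in> zhu_A sf_plus" using that(1) by (simp add: zhu_A_def)
      then show ?thesis
        using N' that(2) zhu_class_self[of u ?M] zhu_class_self[of a sf_plus] by (elim conjE) metis
    qed
    \<comment> \<open>The preimage of \<open>N\<close> under the class map: once it contains
      \<open>sf_minus\<close>, every class lies in \<open>N\<close>.\<close>
    let ?W = "{u. zhu_class ?M u \<in> N}"
    have "?M \<subseteq> ?W"
    proof (rule sf_minus_generated)
      show "sf.subspace ?W"
        by (rule sf.subspaceI) (simp_all add: zero add scale)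
      fix a u assume "a \<in> sf_plus" "u \<in> ?W"
      then show "sf_left a u \<in> ?W" "sf_right u a \<in> ?W"
        using act by simp_all
    qed (use gen in auto)
    then show "zhu_A ?M \<subseteq> N" by (auto simp: zhu_A_def)
  qed
qed

end
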